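(* Let $G=(V,E)$ be an undirected graph with edge-weight vector $\mathbf{w}\in\mathbb{R}_{\ge 0}^{|E|}$ and let $\mathcal{H}$ be a set of unicast sessions in $G$. Let a cut $(V_U,V_V)$ of $V$ partition the session set $\mathcal{H}$ into $\mathcal{H}_U$ (sessions with terminals in $V_U$) and $\mathcal{H}_V$ (sessions with terminals in $V_V$), and let $E_{cut}$ be the set of edges crossing the cut. If there exist two reference nodes $u\in V_U$ and $v\in V_V$, with no direct edge $(u,v)$ in $G$, such that for every cut edge $e=(x,y)\in E_{cut}$ (with $x\in V_U$, $y\in V_V$) $$\tfrac12\,w(x,y)\ \ge\ \max\{d_w(u,x),\,d_w(v,y)\},$$ then the session sets $\mathcal{H}_U$ and $\mathcal{H}_V$ are independent under $\mathbf{w}$.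
   Context: Network model. $G=(V,E)$ is a finite undirected graph. A unicast session is an ordered pair $h_i=(s_i,t_i)$ of vertices (source, sink; its terminals) with demand rate $r_i\ge 0$; $\mathcal{H}=\{h_1,\dots,h_k\}$. $d_w$ is the shortest-path distance in $G$ under $\mathbf{w}$. Each undirected edge $e=\{u,v\}$ is replaced by two opposing arcs $\vec{uv},\vec{vu}$. The sessions have mutually independent source messages $\mathcal{M}=\{M_1,\dots,M_k\}$; $M_i$ is generated at $s_i$ with rate $r_i$ and must be recovered at $t_i$. Coding. A (network) coding solution is understood in the standard sense: the transmission on each arc is a sequence of random variables (symbols), each symbol sent by a node being a function of the messages generated at that node and the symbols it has already received, such that every $t_i$ can decode $M_i$. Its flow $f$ assigns to each arc the rate of transmission on it, and $f(e)=f(\vec{uv})+f(\vec{vu})$ for $e=\{u,v\}$. A minimum-cost coding solution for $\mathcal{H}$ is one satisfying the demands in $\mathcal{H}$ with minimum total cost $\sum_{e\in E}w(e)f(e)$ (no capacity constraints). Independence. Two disjoint subsets $\mathcal{H}_1,\mathcal{H}_2\subseteq\mathcal{H}$ are independent under $\mathbf{w}$ if there exists a minimum-cost coding solution for $\mathcal{H}$ such that, for every $h_i\in\mathcal{H}_1$, every $h_j\in\mathcal{H}_2$, every edge $e\in E$, and every symbol $X$ transmitted on $e$ by that solution, $$I(X;M_i\mid \mathbf{M}_{\setminus\{i\}})\cdot I(X;M_j\mid \mathbf{M}_{\setminus\{j\}})=0,$$ where $\mathbf{M}_{\setminus\{l\}}=\mathcal{M}\setminus\{M_l\}$ and $I$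 denotes (conditional) mutual information.
   Formalization: The formal statement additionally assumes that some coding solution satisfying the demands in H exists; without this (e.g. a source and its sink in different components with positive demand) no minimum-cost solution exists and the claim fails. *)

theory Defs
  imports
    "HOL-Probability.Probability"
    "Graph_Theory.Pair_Digraph"
    "Graph_Theory.Shortest_Path"
begin

section \<open>Graphs, cuts and distances\<close>

definition undirected_graph :: "'v set \<Rightarrow> 'v set set \<Rightarrow> bool" where
  "undirected_graph V E \<longleftrightarrow> finite V \<and> (\<forall>e\<in>E. e \<subseteq> V \<and> card e = 2)"

definition arcs_of :: "'v set set \<Rightarrow> ('v \<times> 'v) set" where
  "arcs_of E = {(x, y). {x, y} \<in> E}"

text \<open>The value is \<open>\<infinity>\<close> for vertices that are not connected.\<close>

definition graph_dist :: "'v set \<Rightarrow> 'v set set \<Rightarrow> ('v set \<Rightarrow> real) \<Rightarrow> 'v \<Rightarrow> 'v \<Rightarrow> ereal" where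
  "graph_dist V E w =
     wf_digraph.\<mu> (with_proj \<lparr>pverts = V, parcs = arcs_of E\<rparr>) (\<lambda>(x, y). w {x, y})"

definition is_cut :: "'v set \<Rightarrow> 'v set \<Rightarrow> 'v set \<Rightarrow> bool" where
  "is_cut V A B \<longleftrightarrow> A \<union> B = V \<and> A \<inter> B = {} \<and> A \<noteq> {} \<and> B \<noteq> {}"

definition cut_edges :: "'v set set \<Rightarrow> 'v set \<Rightarrow> 'v set \<Rightarrow> 'v set set" where
  "cut_edges E A B = {e \<in> E. \<exists>x\<in>A. \<exists>y\<in>B. e = {x, y}}"

section \<open>Sessions\<close>

text \<open>A session is the pair of its source and its sink; its demand rate is given by a
  separate function.\<close>

type_synonym 'v session = "'v \<times> 'v"

definition sessions_in :: "'v session set \<Rightarrow> 'v set \<Rightarrow> 'v session set" where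
  "sessions_in H A = {h \<in> H. fst h \<in> A \<and> snd h \<in> A}"

section \<open>Information measures of finite-valued random variables\<close>

text \<open>These are the notations \<open>\<H>(X)\<close> and \<open>\<I>(X ; Y | Z)\<close> of the locale \<open>information_space\<close>,
  with logarithms to base 2, on the probability space of a \<open>pmf\<close>.\<close>

definition ent :: "nat pmf \<Rightarrow> (nat \<Rightarrow> 'b) \<Rightarrow> real" where
  "ent P X = prob_space.entropy (measure_pmf P) 2 (count_space (range X)) X"

definition cond_mut_info ::
  "nat pmf \<Rightarrow> (nat \<Rightarrow> 'b) \<Rightarrow> (nat \<Rightarrow> 'c) \<Rightarrow> (nat \<Rightarrow> 'd) \<Rightarrow> real" where
  "cond_mut_info P X Y Z = prob_space.conditional_mutual_information (measure_pmf P) 2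
     (count_space (range X)) (count_space (range Y)) (count_space (range Z)) X Y Z"

section \<open>Block codes\<close>

text \<open>A block code serves the demands over \<open>block_length\<close> units of time. Alphabets are finite
  sets of natural numbers. As only finitely many finite-valued messages are involved, \<open>nat\<close> is
  large enough as a sample space for every joint distribution. The list \<open>sent\<close> contains all
  transmissions in chronological order, each as an arc together with the symbol sent on it; the
  transmission on one arc is the corresponding subsequence.\<close>

record 'v block_code =
  block_length :: nat
  sample :: "nat pmf"
  msg :: "'v session \<Rightarrow> nat \<Rightarrow> nat"
  sent :: "(('v \<times> 'v) \<times> (nat \<Rightarrow> nat)) list"

definition received ::
  "(('v \<times> 'v) \<times> (nat \<Rightarrow> nat)) list \<Rightarrow> 'v \<Rightarrow> nat \<Rightarrow> nat list" where
  "received ts x \<omega> = map (\<lambda>(a, X). X \<omega>) (filter (\<lambda>(a, X). snd a = x) ts)"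

definition generated ::
  "'v session set \<Rightarrow> ('v session \<Rightarrow> nat \<Rightarrow> nat) \<Rightarrow> 'v \<Rightarrow> nat \<Rightarrow> 'v session \<Rightarrow> nat" where
  "generated H M x \<omega> = (\<lambda>h\<in>{h \<in> H. fst h = x}. M h \<omega>)"

definition block_code ::
  "'v set set \<Rightarrow> 'v session set \<Rightarrow> ('v session \<Rightarrow> real) \<Rightarrow> 'v block_code \<Rightarrow> bool" where
  "block_code E H r C \<longleftrightarrow>
     0 < block_length C \<and>
     (\<forall>h\<in>H. simple_function (measure_pmf (sample C)) (msg C h)) \<and>
     prob_space.indep_vars (measure_pmf (sample C)) (\<lambda>_. count_space UNIV) (msg C) H \<and>
     (\<forall>h\<in>H. ent (sample C) (msg C h) = real (block_length C) * r h) \<and>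
     (\<forall>i < length (sent C). \<forall>x y X. sent C ! i = ((x, y), X) \<longrightarrow>
        (x, y) \<in> arcs_of E \<and>
        (\<exists>\<phi>. \<forall>\<omega>. X \<omega> = \<phi> (generated H (msg C) x \<omega>) (received (take i (sent C)) x \<omega>))) \<and>
     (\<forall>h\<in>H. \<exists>\<psi>. \<forall>\<omega>.
        msg C h \<omega> = \<psi> (generated H (msg C) (snd h) \<omega>) (received (sent C) (snd h) \<omega>))"

definition on_arc :: "'v block_code \<Rightarrow> 'v \<times> 'v \<Rightarrow> nat \<Rightarrow> nat list" where
  "on_arc C a \<omega> = map (\<lambda>(b, X). X \<omega>) (filter (\<lambda>(b, X). b = a) (sent C))"

definition block_rate :: "'v block_code \<Rightarrow> 'v \<times> 'v \<Rightarrow> real" where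
  "block_rate C a = ent (sample C) (on_arc C a) / real (block_length C)"

section \<open>Coding solutions\<close>

text \<open>Rates are asymptotic, as usual in information theory: a coding solution is a sequence of
  block codes whose rates on each arc converge, and its flow is the limit. A single block code
  is the case of a constant sequence. With one fixed block code per solution, the infimum of the
  costs need not be attained.\<close>

definition coding_solution ::
  "'v set set \<Rightarrow> 'v session set \<Rightarrow> ('v session \<Rightarrow> real) \<Rightarrow> (nat \<Rightarrow> 'v block_code) \<Rightarrow> bool" where
  "coding_solution E H r S \<longleftrightarrow>
     (\<forall>n. block_code E H r (S n)) \<and> (\<forall>a\<in>arcs_of E. convergent (\<lambda>n. block_rate (S n) a))"

definition flow :: "(nat \<Rightarrow> 'v block_code) \<Rightarrow> 'v \<times> 'v \<Rightarrow> real" where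
  "flow S a = lim (\<lambda>n. block_rate (S n) a)"

definition edge_flow :: "(nat \<Rightarrow> 'v block_code) \<Rightarrow> 'v set \<Rightarrow> real" where
  "edge_flow S e = (\<Sum>a\<in>{(x, y). {x, y} = e}. flow S a)"

definition total_cost ::
  "'v set set \<Rightarrow> ('v set \<Rightarrow> real) \<Rightarrow> (nat \<Rightarrow> 'v block_code) \<Rightarrow> real" where
  "total_cost E w S = (\<Sum>e\<in>E. w e * edge_flow S e)"

definition min_cost_coding_solution ::
  "'v set set \<Rightarrow> ('v set \<Rightarrow> real) \<Rightarrow> 'v session set \<Rightarrow> ('v session \<Rightarrow> real)
     \<Rightarrow> (nat \<Rightarrow> 'v block_code) \<Rightarrow> bool" where
  "min_cost_coding_solution E w H r S \<longleftrightarrow>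
     coding_solution E H r S \<and>
     (\<forall>S'. coding_solution E H r S' \<longrightarrow> total_cost E w S \<le> total_cost E w S')"

section \<open>Independence of session sets\<close>

definition symbols_on :: "'v block_code \<Rightarrow> 'v set \<Rightarrow> (nat \<Rightarrow> nat) set" where
  "symbols_on C e = {X. \<exists>x y. e = {x, y} \<and> ((x, y), X) \<in> set (sent C)}"

definition info_about :: "'v session set \<Rightarrow> 'v block_code \<Rightarrow> (nat \<Rightarrow> nat) \<Rightarrow> 'v session \<Rightarrow> real" where
  "info_about H C X h =
     cond_mut_info (sample C) X (msg C h) (\<lambda>\<omega>. \<lambda>h'\<in>H - {h}. msg C h' \<omega>)"

definition independent_sessions ::
  "'v set set \<Rightarrow> ('v set \<Rightarrow> real) \<Rightarrow> 'v session set \<Rightarrow> ('v session \<Rightarrow> real)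
     \<Rightarrow> 'v session set \<Rightarrow> 'v session set \<Rightarrow> bool" where
  "independent_sessions E w H r H1 H2 \<longleftrightarrow>
     H1 \<subseteq> H \<and> H2 \<subseteq> H \<and> H1 \<inter> H2 = {} \<and>
     (\<exists>S. min_cost_coding_solution E w H r S \<and>
       (\<forall>h1\<in>H1. \<forall>h2\<in>H2. \<forall>e\<in>E. \<forall>n. \<forall>X\<in>symbols_on (S n) e.
          info_about H (S n) X h1 * info_about H (S n) X h2 = 0))"

end

theory Submission
  imports Defs
begin

text \<open>Any block code can be split into two codes, one for each side of the cut, without
  increasing the cost. For the side of \<open>u\<close>, fix the messages of the other side and let \<open>u\<close>
  simulate all nodes there: transmissions inside the other side become free, and a transmission
  on a cut edge with end \<open>x\<close> is replaced by one along a shortest path between \<open>u\<close> and \<open>x\<close>,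
  which costs at most half as much. By concavity of entropy the fixed messages can be chosen such
  that the weighted rates do not increase. Both codes together pay at most once for every edge, and
  each symbol depends on the messages of one side only. A minimum-cost solution is a limit of
  such codes along a subsequence, because all rates are bounded by the total demand.\<close>

section \<open>Entropy\<close>

text \<open>In a block code every functional dependence holds for all outcomes, not just almost
  surely. Messages are therefore fixed by composing symbols with a map \<open>g\<close> of the
  sample space that keeps the message values of one side and freezes those of the other. Such a map
  exists because independent messages realise every combination of possible values jointly. One
  frozen outcome has to serve all arcs at once, so the averaging concerns a single weighted sum of
  entropies and never an individual arc. Its weights are the prices after rerouting, because frozen
  symbols are then sent along the routes. Independence speaks of every symbol of every code in the
  sequence. A limit argument alone could not give zero information, so each code is split exactly
  and only the rates pass to the limit.\<close>

lemma information_space_pmf: "information_space (measure_pmf P) 2"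
  by unfold_locales auto

lemma simple_function_pmf_iff: "simple_function (measure_pmf P) X \<longleftrightarrow> finite (range X)"
  by (simp add: simple_function_def)

lemma simple_distributed_pmf:
  "finite (range X) \<Longrightarrow>
    simple_distributed (measure_pmf P) X (\<lambda>x. measure_pmf.prob P (X -` {x}))"
  by (rule measure_pmf.simple_distributedI) (auto simp: simple_function_pmf_iff)

lemma ent_eq_pmf:
  assumes "finite (range X)"
  shows "ent P X = - (\<Sum>x\<in>range X. pmf (map_pmf X P) x * log 2 (pmf (map_pmf X P) x))"
proof -
  interpret information_space "measure_pmf P" 2 by (rule information_space_pmf)
  show ?thesis
    unfolding ent_def
    using entropy_simple_distributed[OF simple_distributed_pmf[OF assms]] by (simp add: pmf_map)
qed

lemma ent_nonneg: "finite (range X) \<Longrightarrow> 0 \<le> ent P X"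
proof -
  assume X: "finite (range X)"
  have "p * log 2 p \<le> 0" if "0 \<le> p" "p \<le> 1" for p :: real
    using that by (cases "p = 0") (auto intro!: mult_nonneg_nonpos)
  then show ?thesis
    unfolding ent_eq_pmf[OF X] by (simp add: sum_nonpos pmf_le_1)
qed

section \<open>Subadditivity and data processing\<close>

lemma ent_pair_le:
  assumes "finite (range X)" "finite (range Y)"
  shows "ent P (\<lambda>\<omega>. (X \<omega>, Y \<omega>)) \<le> ent P X + ent P Y"
proof -
  interpret information_space "measure_pmf P" 2 by (rule information_space_pmf)
  show ?thesis
    using entropy_chain_rule[of X Y] conditional_entropy_less_eq_entropy[of Y X] assms
    by (simp add: ent_def simple_function_pmf_iff)
qed

text \<open>Mediates between two forms of functional dependence: equality at pairs of outcomes, used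
  in the proofs, and composition with a function, used by the definitions and by data
  processing.\<close>

lemma factors_through:
  fixes X :: "'a \<Rightarrow> 'b" and Y :: "'a \<Rightarrow> 'c"
  assumes "\<And>\<omega> \<omega>'. X \<omega> = X \<omega>' \<Longrightarrow> Y \<omega> = Y \<omega>'"
  obtains \<phi> where "Y = \<phi> \<circ> X"
proof
  show "Y = (\<lambda>a. Y (SOME \<omega>. X \<omega> = a)) \<circ> X"
  proof
    fix \<omega>
    have "X (SOME \<omega>'. X \<omega>' = X \<omega>) = X \<omega>" by (rule someI) simp
    from assms[OF this[symmetric]] show "Y \<omega> = ((\<lambda>a. Y (SOME \<omega>. X \<omega> = a)) \<circ> X) \<omega>"
      by (simp only: comp_apply)
  qed
qed

lemma ent_le_of_determined:
  assumes "finite (range X)" "\<And>\<omega> \<omega>'. X \<omega> = X \<omega>' \<Longrightarrow> Y \<omega> = Y \<omega>'"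
  shows "ent P Y \<le> ent P X"
proof -
  interpret information_space "measure_pmf P" 2 by (rule information_space_pmf)
  obtain \<phi> where "Y = \<phi> \<circ> X" using assms(2) by (rule factors_through)
  then show ?thesis
    using entropy_data_processing[of X \<phi>] assms(1) by (simp add: ent_def simple_function_pmf_iff)
qed

lemma finite_range_restrict:
  assumes "finite I" "\<And>i. i \<in> I \<Longrightarrow> finite (range (X i))"
  shows "finite (range (\<lambda>\<omega>. \<lambda>i\<in>I. X i \<omega>))"
proof (rule finite_subset)
  show "range (\<lambda>\<omega>. \<lambda>i\<in>I. X i \<omega>) \<subseteq> (\<Pi>\<^sub>E i\<in>I. range (X i))" by auto
  show "finite (\<Pi>\<^sub>E i\<in>I. range (X i))" using assms by (rule finite_PiE)
qed

lemma finite_range_of_determined: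
  fixes X :: "'i \<Rightarrow> nat \<Rightarrow> 'b" and Y :: "nat \<Rightarrow> 'c"
  assumes "finite I" "\<And>i. i \<in> I \<Longrightarrow> finite (range (X i))"
    and "\<And>\<omega> \<omega>'. (\<And>i. i \<in> I \<Longrightarrow> X i \<omega> = X i \<omega>') \<Longrightarrow> Y \<omega> = Y \<omega>'"
  shows "finite (range Y)"
proof -
  obtain \<phi> where "Y = \<phi> \<circ> (\<lambda>\<omega>. \<lambda>i\<in>I. X i \<omega>)"
  proof (rule factors_through[of "\<lambda>\<omega>. \<lambda>i\<in>I. X i \<omega>" Y])
    show "Y \<omega> = Y \<omega>'" if "(\<lambda>i\<in>I. X i \<omega>) = (\<lambda>i\<in>I. X i \<omega>')" for \<omega> \<omega>'
      by (rule assms(3)) (metis that restrict_apply')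
  qed
  then show ?thesis
    using finite_imageI[OF finite_range_restrict[of I X, OF assms(1,2)], of \<phi>] by (simp add: image_comp)
qed

lemma ent_restrict_le_sum:
  assumes "finite I" "\<And>i. i \<in> I \<Longrightarrow> finite (range (X i))"
  shows "ent P (\<lambda>\<omega>. \<lambda>i\<in>I. X i \<omega>) \<le> (\<Sum>i\<in>I. ent P (X i))"
  using assms
proof (induction I)
  case empty
  show ?case by (simp add: ent_eq_pmf map_pmf_const)
next
  case (insert j I)
  have fin: "finite (range (\<lambda>\<omega>. \<lambda>i\<in>I. X i \<omega>))" "finite (range (X j))"
    using insert by (auto intro: finite_range_restrict)
  have "ent P (\<lambda>\<omega>. \<lambda>i\<in>insert j I. X i \<omega>) \<le> ent P (\<lambda>\<omega>. (X j \<omega>, \<lambda>i\<in>I. X i \<omega>))"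
  proof (rule ent_le_of_determined)
    show "finite (range (\<lambda>\<omega>. (X j \<omega>, \<lambda>i\<in>I. X i \<omega>)))"
      by (rule finite_subset[OF _ finite_cartesian_product[OF fin(2,1)]]) auto
    show "(\<lambda>i\<in>insert j I. X i \<omega>) = (\<lambda>i\<in>insert j I. X i \<omega>')"
      if "(X j \<omega>, \<lambda>i\<in>I. X i \<omega>) = (X j \<omega>', \<lambda>i\<in>I. X i \<omega>')" for \<omega> \<omega>'
      using that by (auto simp: fun_eq_iff restrict_def split: if_splits)
  qed
  also have "\<dots> \<le> ent P (X j) + ent P (\<lambda>\<omega>. \<lambda>i\<in>I. X i \<omega>)"
    using fin by (intro ent_pair_le)
  also have "ent P (\<lambda>\<omega>. \<lambda>i\<in>I. X i \<omega>) \<le> (\<Sum>i\<in>I. ent P (X i))"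
    using insert by blast
  finally show ?case by (simp only: sum.insert[OF insert.hyps])
qed

lemma ent_le_sum_of_determined:
  fixes X :: "'i \<Rightarrow> nat \<Rightarrow> 'b" and Y :: "nat \<Rightarrow> 'c"
  assumes "finite I" "\<And>i. i \<in> I \<Longrightarrow> finite (range (X i))"
    and "\<And>\<omega> \<omega>'. (\<And>i. i \<in> I \<Longrightarrow> X i \<omega> = X i \<omega>') \<Longrightarrow> Y \<omega> = Y \<omega>'"
  shows "ent P Y \<le> (\<Sum>i\<in>I. ent P (X i))"
proof -
  have "ent P Y \<le> ent P (\<lambda>\<omega>. \<lambda>i\<in>I. X i \<omega>)"
  proof (rule ent_le_of_determined[OF finite_range_restrict[of I X, OF assms(1,2)]])
    show "Y \<omega> = Y \<omega>'" if "(\<lambda>i\<in>I. X i \<omega>) = (\<lambda>i\<in>I. X i \<omega>')" for \<omega> \<omega>'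
      by (rule assms(3)) (metis that restrict_apply')
  qed
  also have "\<dots> \<le> (\<Sum>i\<in>I. ent P (X i))"
    using assms(1,2) by (rule ent_restrict_le_sum)
  finally show ?thesis .
qed

text \<open>A summand of Gibbs' inequality, from \<open>ln t \<le> t - 1\<close> at
  \<open>t = q / p\<close>. The linear right-hand side is kept because it cancels when averaged. A
  zero of \<open>q\<close> has to be treated separately.\<close>

lemma gibbs_term:
  fixes p q :: real
  assumes "0 \<le> p" "0 < q"
  shows "p * log 2 q - p * log 2 p \<le> (q - p) / ln 2"
proof (cases "p = 0")
  case False
  with assms have p: "0 < p" by simp
  have "ln (q / p) \<le> q / p - 1" using p assms by (intro ln_le_minus_one) simp
  then have "p * ln (q / p) \<le> p * (q / p - 1)" using p by simp
  then have "p * (ln q - ln p) \<le> q - p" using p assms by (simp add: ln_div algebra_simps)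
  then have "p * (ln q - ln p) / ln 2 \<le> (q - p) / ln 2" by (intro divide_right_mono) auto
  then show ?thesis using p by (simp add: log_def right_diff_distrib diff_divide_distrib)
qed (use assms in auto)

text \<open>Entropy is concave: averaging Gibbs' inequality over the mixture compares each component
  with the mixture.\<close>

lemma expectation_ent_le:
  fixes P Q :: "nat pmf"
  assumes mix: "map_pmf Y P = bind_pmf Q (\<lambda>i. map_pmf (Z i) P)"
    and Y: "finite (range Y)" and Z: "\<And>i. range (Z i) \<subseteq> range Y"
  shows "integrable (measure_pmf Q) (\<lambda>i. ent P (Z i))"
    and "measure_pmf.expectation Q (\<lambda>i. ent P (Z i)) \<le> ent P Y"
proof -
  define p where "p i x = pmf (map_pmf (Z i) P) x" for i x
  define q where "q x = pmf (map_pmf Y P) x" for x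
  have p01: "0 \<le> p i x" "p i x \<le> 1" for i x by (auto simp: p_def pmf_le_1)
  have q: "q x = measure_pmf.expectation Q (\<lambda>i. p i x)" for x
    unfolding q_def mix p_def by (simp add: pmf_bind)
  have intp: "integrable (measure_pmf Q) (\<lambda>i. p i x)" for x
    by (rule measure_pmf.integrable_const_bound[where B = 1]) (auto simp: p01)
  have finZ: "finite (range (Z i))" for i using Y Z by (rule finite_subset[rotated])
  have entZ: "ent P (Z i) = - (\<Sum>x\<in>range Y. p i x * log 2 (p i x))" for i
  proof -
    have "(\<Sum>x\<in>range (Z i). p i x * log 2 (p i x)) = (\<Sum>x\<in>range Y. p i x * log 2 (p i x))"
    proof (rule sum.mono_neutral_left[OF Y Z])
      show "\<forall>x\<in>range Y - range (Z i). p i x * log 2 (p i x) = 0"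
      proof
        fix x assume "x \<in> range Y - range (Z i)"
        then have "x \<notin> set_pmf (map_pmf (Z i) P)" by auto
        then show "p i x * log 2 (p i x) = 0" by (simp add: p_def pmf_eq_0_set_pmf)
      qed
    qed
    then show ?thesis unfolding ent_eq_pmf[OF finZ] p_def by simp
  qed
  \<comment> \<open>\<open>Q\<close> may have infinite support, so integrability needs a uniform
    bound; Gibbs' inequality with \<open>q = 1\<close> supplies the constant.\<close>
  have entb: "\<bar>p i x * log 2 (p i x)\<bar> \<le> 1 / ln 2" for i x
  proof -
    have "p i x * log 2 (p i x) \<le> 0"
      using p01[of i x] by (cases "p i x = 0") (auto intro!: mult_nonneg_nonpos)
    moreover have "- (p i x * log 2 (p i x)) \<le> 1 / ln 2"
    proof -
      have "p i x * log 2 1 - p i x * log 2 (p i x) \<le> (1 - p i x) / ln 2"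
        using p01 by (intro gibbs_term) auto
      also have "\<dots> \<le> 1 / ln 2" using p01 by (intro divide_right_mono) auto
      finally show ?thesis by simp
    qed
    ultimately show ?thesis by linarith
  qed
  show int: "integrable (measure_pmf Q) (\<lambda>i. ent P (Z i))"
    unfolding entZ
    by (intro integrable_minus Bochner_Integration.integrable_sum
        measure_pmf.integrable_const_bound[where B = "1 / ln 2"]) (use entb in auto)
  have "ent P (Z i) \<le> (\<Sum>x\<in>range Y. (q x - p i x) / ln 2 - p i x * log 2 (q x))"
    if i: "i \<in> set_pmf Q" for i
    unfolding entZ sum_negf[symmetric]
  proof (rule sum_mono)
    fix x
    show "- (p i x * log 2 (p i x)) \<le> (q x - p i x) / ln 2 - p i x * log 2 (q x)"
    \<comment> \<open>A value without mass in the mixture has none in any component of positive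
      weight. This is where \<open>i\<close> has to lie in the support of \<open>Q\<close>.\<close>
    proof (cases "q x = 0")
      case True
      then have "x \<notin> set_pmf (map_pmf Y P)" by (simp add: q_def pmf_eq_0_set_pmf)
      then have "x \<notin> set_pmf (map_pmf (Z i) P)" using i unfolding mix by auto
      then have "p i x = 0" by (simp add: p_def pmf_eq_0_set_pmf)
      with True show ?thesis by simp
    next
      case False
      then have "0 < q x" using pmf_nonneg[of "map_pmf Y P" x] unfolding q_def by linarith
      with gibbs_term[OF p01(1) this, of i x] show ?thesis by simp
    qed
  qed
  then have "measure_pmf.expectation Q (\<lambda>i. ent P (Z i))
      \<le> measure_pmf.expectation Q
          (\<lambda>i. \<Sum>x\<in>range Y. (q x - p i x) / ln 2 - p i x * log 2 (q x))"
    by (intro integral_mono_AE int) (auto simp: AE_measure_pmf_iff intp)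
  \<comment> \<open>\<open>q x\<close> is the mean of \<open>p i x\<close>, so the linear terms
    cancel and the cross-entropy becomes the entropy of \<open>Y\<close>.\<close>
  also have "\<dots> = (\<Sum>x\<in>range Y. (q x - q x) / ln 2 - q x * log 2 (q x))"
    by (subst Bochner_Integration.integral_sum) (auto simp: intp q intro!: sum.cong)
  also have "\<dots> = ent P Y" unfolding ent_eq_pmf[OF Y] q_def by (simp add: sum_negf)
  finally show "measure_pmf.expectation Q (\<lambda>i. ent P (Z i)) \<le> ent P Y" .
qed

text \<open>When \<open>Z\<close> determines \<open>X\<close>, the occurring fibres of
  \<open>(X, Y, Z)\<close> and \<open>(X, Z)\<close> are fibres of \<open>(Y, Z)\<close> and
  \<open>Z\<close>. The logarithm in each summand then has argument 1, or its factor is a null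
  probability.\<close>

lemma cond_mut_info_eq_0:
  assumes "finite (range X)" "finite (range Y)" "finite (range Z)"
    and det: "\<And>\<omega> \<omega>'. Z \<omega> = Z \<omega>' \<Longrightarrow> X \<omega> = X \<omega>'"
  shows "cond_mut_info P X Y Z = 0"
proof -
  interpret information_space "measure_pmf P" 2 by (rule information_space_pmf)
  have sf: "simple_function (measure_pmf P) X" "simple_function (measure_pmf P) Y"
    "simple_function (measure_pmf P) Z"
    using assms(1-3) by (auto simp: simple_function_pmf_iff)
  have D: "simple_distributed (measure_pmf P) Z (\<lambda>t. measure_pmf.prob P (Z -` {t}))"
    "simple_distributed (measure_pmf P) (\<lambda>\<omega>. (Y \<omega>, Z \<omega>))
      (\<lambda>t. measure_pmf.prob P ((\<lambda>\<omega>. (Y \<omega>, Z \<omega>)) -` {t}))"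
    "simple_distributed (measure_pmf P) (\<lambda>\<omega>. (X \<omega>, Z \<omega>))
      (\<lambda>t. measure_pmf.prob P ((\<lambda>\<omega>. (X \<omega>, Z \<omega>)) -` {t}))"
    "simple_distributed (measure_pmf P) (\<lambda>\<omega>. (X \<omega>, Y \<omega>, Z \<omega>))
      (\<lambda>t. measure_pmf.prob P ((\<lambda>\<omega>. (X \<omega>, Y \<omega>, Z \<omega>)) -` {t}))"
    by (rule simple_distributed_pmf, simp add: sf simple_function_Pair flip: simple_function_pmf_iff[of P])+
  have eq: "cond_mut_info P X Y Z = (\<Sum>(x, y, z)\<in>range (\<lambda>\<omega>. (X \<omega>, Y \<omega>, Z \<omega>)).
      measure_pmf.prob P ((\<lambda>\<omega>. (X \<omega>, Y \<omega>, Z \<omega>)) -` {(x, y, z)}) *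
      log 2 (measure_pmf.prob P ((\<lambda>\<omega>. (X \<omega>, Y \<omega>, Z \<omega>)) -` {(x, y, z)}) /
        (measure_pmf.prob P ((\<lambda>\<omega>. (X \<omega>, Z \<omega>)) -` {(x, z)}) *
          (measure_pmf.prob P ((\<lambda>\<omega>. (Y \<omega>, Z \<omega>)) -` {(y, z)}) / measure_pmf.prob P (Z -` {z})))))"
    using conditional_mutual_information_eq[OF D] by (simp add: cond_mut_info_def)
  have z: "p * log 2 (p / (q * (p / q))) = 0" if "0 \<le> p" "p \<le> q" for p q :: real
    using that by (cases "p = 0") auto
  show ?thesis
    unfolding eq
  proof (intro sum.neutral ballI, clarify)
    fix \<omega>
    have 1: "(\<lambda>\<omega>. (X \<omega>, Y \<omega>, Z \<omega>)) -` {(X \<omega>, Y \<omega>, Z \<omega>)} = (\<lambda>\<omega>. (Y \<omega>, Z \<omega>)) -` {(Y \<omega>, Z \<omega>)}"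
      by (auto intro: det)
    have 2: "(\<lambda>\<omega>. (X \<omega>, Z \<omega>)) -` {(X \<omega>, Z \<omega>)} = Z -` {Z \<omega>}"
      by (auto intro: det)
    have "measure_pmf.prob P ((\<lambda>\<omega>. (Y \<omega>, Z \<omega>)) -` {(Y \<omega>, Z \<omega>)}) \<le> measure_pmf.prob P (Z -` {Z \<omega>})"
      by (intro measure_pmf.finite_measure_mono) auto
    then show "measure_pmf.prob P ((\<lambda>\<omega>. (X \<omega>, Y \<omega>, Z \<omega>)) -` {(X \<omega>, Y \<omega>, Z \<omega>)}) *
      log 2 (measure_pmf.prob P ((\<lambda>\<omega>. (X \<omega>, Y \<omega>, Z \<omega>)) -` {(X \<omega>, Y \<omega>, Z \<omega>)}) /
        (measure_pmf.prob P ((\<lambda>\<omega>. (X \<omega>, Z \<omega>)) -` {(X \<omega>, Z \<omega>)}) *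
          (measure_pmf.prob P ((\<lambda>\<omega>. (Y \<omega>, Z \<omega>)) -` {(Y \<omega>, Z \<omega>)}) / measure_pmf.prob P (Z -` {Z \<omega>})))) = 0"
      unfolding 1 2 by (intro z measure_nonneg)
  qed
qed

section \<open>Causal transmission sequences\<close>

text \<open>Knowledge as indistinguishability: node \<open>x\<close> observes the same at both
  outcomes. Simulations can then compare outcomes instead of constructing coding functions, and the
  order of the received symbols no longer matters.\<close>

definition knows ::
  "'v session set \<Rightarrow> ('v session \<Rightarrow> nat \<Rightarrow> nat) \<Rightarrow> (('v \<times> 'v) \<times> (nat \<Rightarrow> nat)) list
     \<Rightarrow> 'v \<Rightarrow> nat \<Rightarrow> nat \<Rightarrow> bool" where
  "knows H M ts x \<omega> \<omega>' \<longleftrightarrow>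
     (\<forall>h\<in>H. fst h = x \<longrightarrow> M h \<omega> = M h \<omega>') \<and> (\<forall>y X. ((y, x), X) \<in> set ts \<longrightarrow> X \<omega> = X \<omega>')"

inductive causal ::
  "('v \<times> 'v) set \<Rightarrow> 'v session set \<Rightarrow> ('v session \<Rightarrow> nat \<Rightarrow> nat)
     \<Rightarrow> (('v \<times> 'v) \<times> (nat \<Rightarrow> nat)) list \<Rightarrow> bool"
  for A H M where
  causal_Nil: "causal A H M []"
| causal_snoc: "causal A H M ts \<Longrightarrow> (x, y) \<in> A
    \<Longrightarrow> (\<And>\<omega> \<omega>'. knows H M ts x \<omega> \<omega>' \<Longrightarrow> X \<omega> = X \<omega>') \<Longrightarrow> causal A H M (ts @ [((x, y), X)])"

lemma knows_mono:
  "knows H M ts' x \<omega> \<omega>' \<Longrightarrow> set ts \<subseteq> set ts' \<Longrightarrow> knows H M ts x \<omega> \<omega>'"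
  unfolding knows_def by blast

lemma knows_iff:
  "knows H M ts x \<omega> \<omega>' \<longleftrightarrow>
     generated H M x \<omega> = generated H M x \<omega>' \<and> received ts x \<omega> = received ts x \<omega>'"
proof -
  have "generated H M x \<omega> = generated H M x \<omega>' \<longleftrightarrow> (\<forall>h\<in>H. fst h = x \<longrightarrow> M h \<omega> = M h \<omega>')"
    (is "?g = ?g' \<longleftrightarrow> _")
  proof
    assume "?g = ?g'"
    then show "\<forall>h\<in>H. fst h = x \<longrightarrow> M h \<omega> = M h \<omega>'"
      unfolding generated_def by (metis (mono_tags, lifting) mem_Collect_eq restrict_apply')
  next
    assume "\<forall>h\<in>H. fst h = x \<longrightarrow> M h \<omega> = M h \<omega>'"
    then show "?g = ?g'" unfolding generated_def by (intro restrict_ext) blast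
  qed
  moreover have "received ts x \<omega> = received ts x \<omega>' \<longleftrightarrow>
      (\<forall>y X. ((y, x), X) \<in> set ts \<longrightarrow> X \<omega> = X \<omega>')"
    unfolding received_def map_eq_conv by auto
  ultimately show ?thesis unfolding knows_def by blast
qed

lemma function_of_iff_knows:
  fixes X :: "nat \<Rightarrow> nat"
  shows "(\<exists>\<phi>. \<forall>\<omega>. X \<omega> = \<phi> (generated H M x \<omega>) (received ts x \<omega>)) \<longleftrightarrow>
    (\<forall>\<omega> \<omega>'. knows H M ts x \<omega> \<omega>' \<longrightarrow> X \<omega> = X \<omega>')"
    (is "?L \<longleftrightarrow> ?R")
proof
  assume ?R
  then have "\<And>\<omega> \<omega>'. (generated H M x \<omega>, received ts x \<omega>) = (generated H M x \<omega>', received ts x \<omega>')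
      \<Longrightarrow> X \<omega> = X \<omega>'"
    unfolding knows_iff prod.inject by blast
  then obtain \<phi> where "X = \<phi> \<circ> (\<lambda>\<omega>. (generated H M x \<omega>, received ts x \<omega>))"
    by (rule factors_through)
  then have "\<forall>\<omega>. X \<omega> = curry \<phi> (generated H M x \<omega>) (received ts x \<omega>)"
    by (simp only: comp_apply curry_conv simp_thms)
  then show ?L by blast
next
  assume ?L
  then show ?R by (metis knows_iff)
qed

lemma causal_snoc_iff:
  "causal A H M (ts @ [((x, y), X)]) \<longleftrightarrow>
    causal A H M ts \<and> (x, y) \<in> A \<and> (\<forall>\<omega> \<omega>'. knows H M ts x \<omega> \<omega>' \<longrightarrow> X \<omega> = X \<omega>')"
    (is "?L \<longleftrightarrow> ?R")
proof
  assume ?L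
  then show ?R by cases blast+
next
  assume ?R
  then show ?L by (blast intro: causal_snoc)
qed

lemma causal_iff:
  "causal A H M ts \<longleftrightarrow>
    (\<forall>i < length ts. \<forall>x y X. ts ! i = ((x, y), X) \<longrightarrow>
       (x, y) \<in> A \<and> (\<exists>\<phi>. \<forall>\<omega>. X \<omega> = \<phi> (generated H M x \<omega>) (received (take i ts) x \<omega>)))"
    (is "_ \<longleftrightarrow> ?R ts")
proof (induction ts rule: rev_induct)
  case Nil
  show ?case by (simp add: causal_Nil)
next
  case (snoc t ts)
  obtain x y X where t: "t = ((x, y), X)" by (metis surj_pair)
  have "causal A H M (ts @ [t]) \<longleftrightarrow> ?R ts \<and> (x, y) \<in> A \<and>
      (\<exists>\<phi>. \<forall>\<omega>. X \<omega> = \<phi> (generated H M x \<omega>) (received ts x \<omega>))"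
    unfolding t causal_snoc_iff snoc.IH function_of_iff_knows by (rule refl)
  also have "\<dots> \<longleftrightarrow> ?R (ts @ [t])"
    by (auto simp: t nth_append less_Suc_eq)
  finally show ?case .
qed

text \<open>Eliminates all encoding and decoding functions; codes are handled in this form from here
  on.\<close>

lemma block_code_iff_causal:
  "block_code E H r C \<longleftrightarrow>
     0 < block_length C \<and>
     (\<forall>h\<in>H. finite (range (msg C h))) \<and>
     prob_space.indep_vars (measure_pmf (sample C)) (\<lambda>_. count_space UNIV) (msg C) H \<and>
     (\<forall>h\<in>H. ent (sample C) (msg C h) = real (block_length C) * r h) \<and>
     causal (arcs_of E) H (msg C) (sent C) \<and>
     (\<forall>h\<in>H. \<forall>\<omega> \<omega>'. knows H (msg C) (sent C) (snd h) \<omega> \<omega>' \<longrightarrow> msg C h \<omega> = msg C h \<omega>')"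
  unfolding block_code_def function_of_iff_knows causal_iff simple_function_pmf_iff by (rule refl)

lemma causal_arc: "causal A H M ts \<Longrightarrow> (a, X) \<in> set ts \<Longrightarrow> a \<in> A"
  by (induction rule: causal.induct) auto

text \<open>Nodes have no randomness of their own, so by induction along the schedule every symbol
  is a function of all messages.\<close>

lemma causal_determined:
  assumes "causal A H M ts"
  shows "(a, X) \<in> set ts \<Longrightarrow> (\<And>h. h \<in> H \<Longrightarrow> M h \<omega> = M h \<omega>') \<Longrightarrow> X \<omega> = X \<omega>'"
  using assms
proof (induction arbitrary: a X rule: causal.induct)
  case (causal_snoc ts x y Y)
  have "knows H M ts x \<omega> \<omega>'"
    unfolding knows_def using causal_snoc.IH causal_snoc.prems(2) by blast
  then have "Y \<omega> = Y \<omega>'" by (rule causal_snoc.hyps(3))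
  with causal_snoc.IH causal_snoc.prems show ?case by (cases a) auto
qed simp

text \<open>Additional earlier symbols only refine what a sender knows. This allows the codes of the
  two sides to run one after the other.\<close>

lemma causal_append:
  assumes "causal A H M ts" "causal A H M ts'"
  shows "causal A H M (ts @ ts')"
  using assms(2)
proof (induction rule: causal.induct)
  case (causal_snoc ts' x y X)
  have "X \<omega> = X \<omega>'" if "knows H M (ts @ ts') x \<omega> \<omega>'" for \<omega> \<omega>'
    by (rule causal_snoc.hyps(3), rule knows_mono[OF that]) auto
  then have "causal A H M ((ts @ ts') @ [((x, y), X)])"
    by (rule causal.causal_snoc[OF causal_snoc.IH causal_snoc.hyps(2)])
  then show ?case by simp
qed (simp add: assms)

text \<open>\<open>on_arc\<close> for a bare schedule, as the schedules of the two sides are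
  measured before they form a code.\<close>

definition transmissions_on :: "(('v \<times> 'v) \<times> (nat \<Rightarrow> nat)) list \<Rightarrow> 'v \<times> 'v \<Rightarrow> nat \<Rightarrow> nat list" where
  "transmissions_on ts a \<omega> = map (\<lambda>(b, X). X \<omega>) (filter (\<lambda>(b, X). b = a) ts)"

lemma on_arc_eq: "on_arc C a = transmissions_on (sent C) a"
  by (simp add: fun_eq_iff on_arc_def transmissions_on_def)

lemma transmissions_on_eq_iff:
  "transmissions_on ts a \<omega> = transmissions_on ts a \<omega>' \<longleftrightarrow>
    (\<forall>X. (a, X) \<in> set ts \<longrightarrow> X \<omega> = X \<omega>')"
  by (cases a) (auto simp: transmissions_on_def)

lemma transmissions_on_append:
  "transmissions_on (ts @ ts') a \<omega> = transmissions_on ts a \<omega> @ transmissions_on ts' a \<omega>"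
  by (simp add: transmissions_on_def)

lemma transmissions_on_determined:
  assumes "causal A H M ts" "\<And>h. h \<in> H \<Longrightarrow> M h \<omega> = M h \<omega>'"
  shows "transmissions_on ts a \<omega> = transmissions_on ts a \<omega>'"
  using causal_determined[OF assms(1) _ assms(2)] by (auto simp: transmissions_on_eq_iff)

lemma finite_range_transmissions_on:
  assumes "causal A H M ts" "finite H" "\<And>h. h \<in> H \<Longrightarrow> finite (range (M h))"
  shows "finite (range (transmissions_on ts a))"
  by (rule finite_range_of_determined[of H M]) (use assms in \<open>auto intro: transmissions_on_determined\<close>)

lemma finite_range_symbol:
  assumes "causal A H M ts" "finite H" "\<And>h. h \<in> H \<Longrightarrow> finite (range (M h))" "(a, X) \<in> set ts"
  shows "finite (range X)"
  by (rule finite_range_of_determined[of H M]) (use assms in \<open>auto intro: causal_determined\<close>)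

section \<open>Simulation along routes\<close>

definition relay ::
  "('v \<times> 'v \<Rightarrow> ('v \<times> 'v) list) \<Rightarrow> (nat \<Rightarrow> nat) \<Rightarrow> (('v \<times> 'v) \<times> (nat \<Rightarrow> nat)) list
     \<Rightarrow> (('v \<times> 'v) \<times> (nat \<Rightarrow> nat)) list" where
  "relay route g ts = concat (map (\<lambda>(a, X). map (\<lambda>b. (b, X \<circ> g)) (route a)) ts)"

lemma relay_snoc: "relay route g (ts @ [(a, X)]) = relay route g ts @ map (\<lambda>b. (b, X \<circ> g)) (route a)"
  by (simp add: relay_def)

lemma set_relay:
  "(b, Y) \<in> set (relay route g ts) \<longleftrightarrow> (\<exists>a X. (a, X) \<in> set ts \<and> b \<in> set (route a) \<and> Y = X \<circ> g)"
  unfolding relay_def by (fastforce split: prod.splits)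

context pair_wf_digraph
begin

lemma awalk_last_arc: "awalk x p y \<Longrightarrow> p \<noteq> [] \<Longrightarrow> \<exists>z. (z, y) \<in> set p"
proof (induction p arbitrary: x)
  case (Cons e p)
  then show ?case by (cases "p = []"; cases e) (force simp: awalk_Cons_iff awalk_Nil_iff)+
qed simp

text \<open>Store and forward: after each hop the next node knows \<open>X\<close> from the arc just
  used, so the induction lets the schedule grow.\<close>

lemma causal_along_walk:
  assumes "causal (parcs G) H M ts" "awalk x p y"
    and "\<And>\<omega> \<omega>'. knows H M ts x \<omega> \<omega>' \<Longrightarrow> X \<omega> = X \<omega>'"
  shows "causal (parcs G) H M (ts @ map (\<lambda>b. (b, X)) p)"
  using assms
proof (induction p arbitrary: x ts)
  case (Cons e p)
  then obtain z where e: "e = (x, z)" "(x, z) \<in> parcs G" "awalk z p y"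
    by (cases e) (auto simp: awalk_Cons_iff)
  have "causal (parcs G) H M (ts @ [((x, z), X)])"
    using Cons.prems(1) e(2) Cons.prems(3) by (rule causal_snoc)
  then have "causal (parcs G) H M ((ts @ [((x, z), X)]) @ map (\<lambda>b. (b, X)) p)"
    by (rule Cons.IH[OF _ e(3)]) (auto simp: knows_def)
  then show ?case by (simp add: e)
qed simp

text \<open>The code is simulated on the image of the node map \<open>\<pi>\<close>: node \<open>\<pi> x\<close> plays the
  role of \<open>x\<close>. A node that is merged into another one is reached by an empty route, so that
  its symbols need not be transmitted.\<close>

lemma relay_simulates:
  assumes "causal A H M ts"
    and walk: "\<And>x y. (x, y) \<in> A \<Longrightarrow> awalk (\<pi> x) (route (x, y)) (\<pi> y)"
    and gen: "\<And>h \<omega> \<omega>'. h \<in> H \<Longrightarrow> (\<forall>h'\<in>H. fst h' = \<pi> (fst h) \<longrightarrow> M' h' \<omega> = M' h' \<omega>')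
      \<Longrightarrow> M h (g \<omega>) = M h (g \<omega>')"
  shows "causal (parcs G) H M' (relay route g ts)"
    and "knows H M' (relay route g ts) (\<pi> x) \<omega> \<omega>' \<Longrightarrow> knows H M ts x (g \<omega>) (g \<omega>')"
proof -
  have "causal (parcs G) H M' (relay route g ts) \<and>
    (\<forall>x \<omega> \<omega>'. knows H M' (relay route g ts) (\<pi> x) \<omega> \<omega>' \<longrightarrow> knows H M ts x (g \<omega>) (g \<omega>'))"
    using assms(1)
  proof (induction rule: causal.induct)
    case causal_Nil
    show ?case
      using gen by (auto simp: relay_def knows_def intro: causal.causal_Nil)
  next
    case (causal_snoc ts x y X)
    let ?R = "relay route g ts" and ?R' = "relay route g (ts @ [((x, y), X)])"
    note walk = walk[OF \<open>(x, y) \<in> A\<close>]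
    have "causal (parcs G) H M' ?R'"
      unfolding relay_snoc
    proof (rule causal_along_walk[OF _ walk])
      show "(X \<circ> g) \<omega> = (X \<circ> g) \<omega>'" if "knows H M' ?R (\<pi> x) \<omega> \<omega>'" for \<omega> \<omega>'
        using that causal_snoc.IH causal_snoc.hyps(3) unfolding comp_apply by blast
    qed (use causal_snoc.IH in blast)
    moreover have "knows H M (ts @ [((x, y), X)]) z (g \<omega>) (g \<omega>')"
      if "knows H M' ?R' (\<pi> z) \<omega> \<omega>'" for z \<omega> \<omega>'
    proof -
      have "knows H M' ?R (\<pi> z) \<omega> \<omega>'"
        using that by (rule knows_mono) (simp add: relay_snoc)
      then have z: "knows H M ts z (g \<omega>) (g \<omega>')" using causal_snoc.IH by blast
      \<comment> \<open>An empty route means that sender and receiver have the same image, which can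
        compute \<open>X\<close> already. A nonempty route ends with an arc into
        \<open>\<pi> z\<close> that carries the symbol.\<close>
      moreover have "X (g \<omega>) = X (g \<omega>')" if "y = z"
      proof (cases "route (x, y) = []")
        case True
        then have "\<pi> x = \<pi> z" using walk \<open>y = z\<close> by (simp add: awalk_Nil_iff)
        then show ?thesis
          using \<open>knows H M' ?R (\<pi> z) \<omega> \<omega>'\<close> causal_snoc.IH causal_snoc.hyps(3) by metis
      next
        case False
        then obtain z' where "(z', \<pi> z) \<in> set (route (x, y))"
          using walk \<open>y = z\<close> awalk_last_arc by blast
        then have "((z', \<pi> z), X \<circ> g) \<in> set ?R'"
          by (auto simp: relay_snoc)
        then show ?thesis
          using \<open>knows H M' ?R' (\<pi> z) \<omega> \<omega>'\<close> unfolding knows_def comp_def by blast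
      qed
      ultimately show ?thesis unfolding knows_def by auto
    qed
    ultimately show ?case by blast
  qed
  then show "causal (parcs G) H M' (relay route g ts)"
    and "knows H M' (relay route g ts) (\<pi> x) \<omega> \<omega>' \<Longrightarrow> knows H M ts x (g \<omega>) (g \<omega>')"
    by blast+
qed

end

text \<open>A route may repeat arcs: its cost counts them with multiplicity, whereas repeating a
  symbol on an arc adds no entropy.\<close>

lemma sum_set_le_sum_list:
  fixes c :: "'a \<Rightarrow> real"
  assumes "\<And>x. x \<in> set xs \<Longrightarrow> 0 \<le> c x"
  shows "sum c (set xs) \<le> sum_list (map c xs)"
  using assms by (induction xs) (auto simp: sum.insert_if add_increasing)

text \<open>What is sent on \<open>b\<close> is determined by the original transmissions on the arcs
  routed through \<open>b\<close>, so subadditivity applies. Exchanging the sums collects the cost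
  of a whole route at its original arc.\<close>

lemma weighted_ent_relay_le:
  fixes c :: "'v \<times> 'v \<Rightarrow> real"
  assumes "finite A" "finite B" "fst ` set ts \<subseteq> A" "\<And>a. a \<in> A \<Longrightarrow> set (route a) \<subseteq> B"
    and c: "\<And>b. b \<in> B \<Longrightarrow> 0 \<le> c b"
    and fin: "\<And>a. finite (range (transmissions_on ts a))"
  shows "(\<Sum>b\<in>B. c b * ent P (transmissions_on (relay route g ts) b))
    \<le> (\<Sum>a\<in>A. sum_list (map c (route a)) * ent P (transmissions_on ts a \<circ> g))"
proof -
  have fing: "finite (range (transmissions_on ts a \<circ> g))" for a
    by (rule finite_subset[OF _ fin[of a]]) auto
  have "(\<Sum>b\<in>B. c b * ent P (transmissions_on (relay route g ts) b))
      \<le> (\<Sum>b\<in>B. c b * (\<Sum>a\<in>{a\<in>A. b \<in> set (route a)}. ent P (transmissions_on ts a \<circ> g)))"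
  proof (intro sum_mono mult_left_mono c ent_le_sum_of_determined fing)
    fix b \<omega> \<omega>'
    assume eq: "\<And>a. a \<in> {a\<in>A. b \<in> set (route a)} \<Longrightarrow>
      (transmissions_on ts a \<circ> g) \<omega> = (transmissions_on ts a \<circ> g) \<omega>'"
    show "transmissions_on (relay route g ts) b \<omega> = transmissions_on (relay route g ts) b \<omega>'"
      unfolding transmissions_on_eq_iff set_relay
    proof clarify
      fix a X assume "(a, X) \<in> set ts" "b \<in> set (route a)"
      moreover from this have "a \<in> A" using assms(3) by force
      ultimately show "(X \<circ> g) \<omega> = (X \<circ> g) \<omega>'"
        using eq[of a] by (auto simp: transmissions_on_eq_iff)
    qed
  qed (use assms in auto)
  also have "\<dots> = (\<Sum>b\<in>B. \<Sum>a\<in>A.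
      if b \<in> set (route a) then c b * ent P (transmissions_on ts a \<circ> g) else 0)"
    using assms(1) by (auto simp: sum_distrib_left sum.inter_filter intro!: sum.cong)
  also have "\<dots> = (\<Sum>a\<in>A. \<Sum>b\<in>B.
      if b \<in> set (route a) then c b * ent P (transmissions_on ts a \<circ> g) else 0)"
    by (rule sum.swap)
  also have "\<dots> \<le> (\<Sum>a\<in>A. sum_list (map c (route a)) * ent P (transmissions_on ts a \<circ> g))"
  proof (rule sum_mono)
    fix a assume a: "a \<in> A"
    let ?h = "ent P (transmissions_on ts a \<circ> g)"
    have "(\<Sum>b\<in>B. if b \<in> set (route a) then c b * ?h else 0) = (\<Sum>b\<in>set (route a). c b) * ?h"
      using assms(2) assms(4)[OF a]
      by (auto simp: sum.inter_filter[symmetric] sum_distrib_right intro!: sum.cong)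
    also have "\<dots> \<le> sum_list (map c (route a)) * ?h"
      using assms(4)[OF a] c
      by (intro mult_right_mono[OF _ ent_nonneg[OF fing]] sum_set_le_sum_list) blast
    finally show "(\<Sum>b\<in>B. if b \<in> set (route a) then c b * ?h else 0)
      \<le> sum_list (map c (route a)) * ?h" .
  qed
  finally show ?thesis .
qed

section \<open>Fixing the messages of one side\<close>

text \<open>Replacing outcomes of probability zero makes every combination of values of independent
  messages that occurs separately also occur jointly.\<close>

definition to_support :: "nat pmf \<Rightarrow> nat \<Rightarrow> nat" where
  "to_support P \<omega> = (if \<omega> \<in> set_pmf P then \<omega> else (SOME \<omega>'. \<omega>' \<in> set_pmf P))"

lemma to_support_in: "to_support P \<omega> \<in> set_pmf P"
  using someI_ex[of "\<lambda>\<omega>'. \<omega>' \<in> set_pmf P"] set_pmf_not_empty[of P] by (auto simp: to_support_def)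

lemma to_support_id: "\<omega> \<in> set_pmf P \<Longrightarrow> to_support P \<omega> = \<omega>"
  by (simp add: to_support_def)

lemma map_pmf_to_support: "map_pmf (X \<circ> to_support P) P = map_pmf X P"
  by (rule map_pmf_cong) (simp_all add: to_support_id)

text \<open>\<open>to_support\<close> may shrink the range of a message; values of probability zero
  contribute nothing, so the demanded entropy is kept.\<close>

lemma ent_cong_distribution:
  assumes "map_pmf X P = map_pmf Y P" "finite (range X)" "finite (range Y)"
  shows "ent P X = ent P Y"
proof -
  have "ent P Z = - (\<Sum>x\<in>set_pmf (map_pmf Z P). pmf (map_pmf Z P) x * log 2 (pmf (map_pmf Z P) x))"
    if "finite (range Z)" for Z :: "nat \<Rightarrow> 'a"
    unfolding ent_eq_pmf[OF that] neg_equal_iff_equal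
    by (rule sum.mono_neutral_right[OF that]) (auto simp: pmf_eq_0_set_pmf)
  with assms show ?thesis by metis
qed

section \<open>Independence of blocks of messages\<close>

lemma indep_vars_map_pmf:
  assumes "prob_space.indep_vars (measure_pmf (map_pmf f P)) (\<lambda>_. count_space UNIV) M H"
  shows "prob_space.indep_vars (measure_pmf P) (\<lambda>_. count_space UNIV) (\<lambda>h. M h \<circ> f) H"
  unfolding prob_space.indep_vars_def2[OF prob_space_measure_pmf]
    prob_space.indep_sets_def[OF prob_space_measure_pmf]
proof (intro conjI ballI allI impI)
  fix J A assume J: "J \<subseteq> H" "J \<noteq> {}" "finite J"
    and A: "A \<in> (\<Pi> j\<in>J. {(M j \<circ> f) -` A \<inter> space (measure_pmf P) |A. A \<in> sets (count_space UNIV)})"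
  then have "\<forall>j\<in>J. \<exists>B. A j = f -` (M j -` B)" by (auto simp: Pi_iff vimage_comp)
  then obtain B where B: "\<And>j. j \<in> J \<Longrightarrow> A j = f -` (M j -` B j)" by metis
  have "(\<Inter>j\<in>J. A j) = f -` (\<Inter>j\<in>J. M j -` B j)" using B by auto
  then have "measure_pmf.prob P (\<Inter>j\<in>J. A j) = measure_pmf.prob (map_pmf f P) (\<Inter>j\<in>J. M j -` B j)"
    by simp
  also have "\<dots> = (\<Prod>j\<in>J. measure_pmf.prob (map_pmf f P) (M j -` B j))"
    using prob_space.indep_varsD[OF prob_space_measure_pmf assms J(2,3,1), of B] by simp
  also have "\<dots> = (\<Prod>j\<in>J. measure_pmf.prob P (A j))"
    using B by (intro prod.cong) simp_all
  finally show "measure_pmf.prob P (\<Inter>j\<in>J. A j) = (\<Prod>j\<in>J. measure_pmf.prob P (A j))" .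
qed auto

lemma prob_tuple_indep:
  assumes "prob_space.indep_vars (measure_pmf P) (\<lambda>_. count_space UNIV) M H"
    and "finite K" "K \<subseteq> H" "a \<in> extensional K"
  shows "measure_pmf.prob P ((\<lambda>\<omega>. \<lambda>h\<in>K. M h \<omega>) -` {a}) = (\<Prod>h\<in>K. measure_pmf.prob P (M h -` {a h}))"
proof (cases "K = {}")
  case True
  then have "(\<lambda>\<omega>. \<lambda>h\<in>K. M h \<omega>) -` {a} = UNIV" using assms(4) by auto
  with True show ?thesis by simp
next
  case False
  have "(\<lambda>\<omega>. \<lambda>h\<in>K. M h \<omega>) -` {a} = (\<Inter>h\<in>K. M h -` {a h})"
    using assms(4) by (auto simp: extensional_def fun_eq_iff restrict_def)
  then show ?thesis
    using prob_space.indep_varsD[OF prob_space_measure_pmf assms(1) False assms(2,3), of "\<lambda>h. {a h}"] by simp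
qed

text \<open>Gluing two tuples gives one tuple over \<open>K \<union> L\<close>, whose probability is
  a product that splits into the two blocks. Pairs that are not extensional have mass zero on both
  sides.\<close>

lemma joint_tuple_indep:
  assumes "prob_space.indep_vars (measure_pmf P) (\<lambda>_. count_space UNIV) M (K \<union> L)"
    and "finite K" "finite L" "K \<inter> L = {}"
  shows "map_pmf (\<lambda>\<omega>. (\<lambda>h\<in>K. M h \<omega>, \<lambda>h\<in>L. M h \<omega>)) P
    = pair_pmf (map_pmf (\<lambda>\<omega>. \<lambda>h\<in>K. M h \<omega>) P) (map_pmf (\<lambda>\<omega>. \<lambda>h\<in>L. M h \<omega>) P)"
    (is "map_pmf ?T P = ?R")
proof (rule pmf_eqI, clarify)
  fix a b
  show "pmf (map_pmf ?T P) (a, b) = pmf ?R (a, b)"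
  proof (cases "a \<in> extensional K \<and> b \<in> extensional L")
    case True
    define c where "c = (\<lambda>h\<in>K \<union> L. if h \<in> K then a h else b h)"
    have eq: "?T -` {(a, b)} = (\<lambda>\<omega>. \<lambda>h\<in>K \<union> L. M h \<omega>) -` {c}"
    proof -
      have "?T \<omega> = (a, b) \<longleftrightarrow> (\<forall>h\<in>K. M h \<omega> = a h) \<and> (\<forall>h\<in>L. M h \<omega> = b h)" for \<omega>
        using True by (auto simp: extensional_def fun_eq_iff restrict_def)
      moreover have "(\<lambda>h\<in>K \<union> L. M h \<omega>) = c \<longleftrightarrow>
          (\<forall>h\<in>K. M h \<omega> = a h) \<and> (\<forall>h\<in>L. M h \<omega> = b h)" for \<omega>
        using assms(4) by (auto simp: c_def fun_eq_iff restrict_def)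
      ultimately show ?thesis by (simp only: vimage_singleton_eq set_eq_iff simp_thms)
    qed
    have "c \<in> extensional (K \<union> L)" by (simp add: c_def)
    then have "pmf (map_pmf ?T P) (a, b) = (\<Prod>h\<in>K \<union> L. measure_pmf.prob P (M h -` {c h}))"
      unfolding pmf_map eq using assms by (intro prob_tuple_indep) auto
    also have "\<dots> = (\<Prod>h\<in>K. measure_pmf.prob P (M h -` {c h})) * (\<Prod>h\<in>L. measure_pmf.prob P (M h -` {c h}))"
      using assms by (intro prod.union_disjoint)
    also have "(\<Prod>h\<in>K. measure_pmf.prob P (M h -` {c h})) = (\<Prod>h\<in>K. measure_pmf.prob P (M h -` {a h}))"
      by (intro prod.cong) (auto simp: c_def)
    also have "(\<Prod>h\<in>L. measure_pmf.prob P (M h -` {c h})) = (\<Prod>h\<in>L. measure_pmf.prob P (M h -` {b h}))"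
      using assms(4) by (intro prod.cong) (auto simp: c_def)
    also have "(\<Prod>h\<in>K. measure_pmf.prob P (M h -` {a h})) * (\<Prod>h\<in>L. measure_pmf.prob P (M h -` {b h}))
        = pmf ?R (a, b)"
      unfolding pmf_pair pmf_map using True assms
      by (intro arg_cong2[where f = "(*)"] prob_tuple_indep[symmetric, OF assms(1)]) auto
    finally show ?thesis .
  next
    case False
    then have "(a, b) \<notin> set_pmf (map_pmf ?T P)" "(a, b) \<notin> set_pmf ?R" by auto
    then show ?thesis by (simp only: pmf_eq_0_set_pmf[symmetric])
  qed
qed

text \<open>The support of a product distribution is the product of the supports, so two tuples of
  positive probability occur together at some outcome.\<close>

lemma joint_outcome_exists:
  assumes "prob_space.indep_vars (measure_pmf P) (\<lambda>_. count_space UNIV) M (K \<union> L)"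
    and "finite K" "finite L" "K \<inter> L = {}"
  shows "\<exists>g. \<forall>\<omega>0 \<omega>. (\<forall>h\<in>K. M h (g \<omega>0 \<omega>) = M h (to_support P \<omega>)) \<and>
    (\<forall>h\<in>L. M h (g \<omega>0 \<omega>) = M h (to_support P \<omega>0))"
proof -
  have "\<exists>\<tau>. (\<forall>h\<in>K. M h \<tau> = M h (to_support P \<omega>)) \<and> (\<forall>h\<in>L. M h \<tau> = M h (to_support P \<omega>0))" for \<omega> \<omega>0
  proof -
    have "(\<lambda>h\<in>K. M h (to_support P \<omega>), \<lambda>h\<in>L. M h (to_support P \<omega>0))
        \<in> set_pmf (map_pmf (\<lambda>\<omega>. (\<lambda>h\<in>K. M h \<omega>, \<lambda>h\<in>L. M h \<omega>)) P)"
      unfolding joint_tuple_indep[OF assms] by (auto simp: to_support_in)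
    then obtain \<tau> where "(\<lambda>h\<in>K. M h \<tau>) = (\<lambda>h\<in>K. M h (to_support P \<omega>))"
      "(\<lambda>h\<in>L. M h \<tau>) = (\<lambda>h\<in>L. M h (to_support P \<omega>0))" by auto
    then show ?thesis by (metis restrict_apply')
  qed
  then have "\<forall>\<omega>0 \<omega>. \<exists>\<tau>. (\<forall>h\<in>K. M h \<tau> = M h (to_support P \<omega>)) \<and>
      (\<forall>h\<in>L. M h \<tau> = M h (to_support P \<omega>0))" by blast
  then show ?thesis unfolding choice_iff .
qed

text \<open>By independence, taking the messages in \<open>L\<close> and those in \<open>K\<close>
  from two separate draws reproduces their joint law. This presents \<open>Y\<close> as the mixture
  that concavity of entropy requires.\<close>

lemma mixture_of_determined:
  assumes indep: "prob_space.indep_vars (measure_pmf P) (\<lambda>_. count_space UNIV) M (K \<union> L)"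
    and fin: "finite K" "finite L" and disj: "K \<inter> L = {}"
    and g: "\<And>\<omega>0 \<omega> h. h \<in> K \<Longrightarrow> M h (g \<omega>0 \<omega>) = M h (to_support P \<omega>)"
      "\<And>\<omega>0 \<omega> h. h \<in> L \<Longrightarrow> M h (g \<omega>0 \<omega>) = M h (to_support P \<omega>0)"
    and Y: "\<And>\<omega> \<omega>'. (\<And>h. h \<in> K \<union> L \<Longrightarrow> M h \<omega> = M h \<omega>') \<Longrightarrow> Y \<omega> = Y \<omega>'"
  shows "map_pmf Y P = bind_pmf P (\<lambda>\<omega>0. map_pmf (Y \<circ> g \<omega>0) P)"
proof -
  let ?K = "\<lambda>\<omega>. \<lambda>h\<in>K. M h \<omega>" and ?L = "\<lambda>\<omega>. \<lambda>h\<in>L. M h \<omega>"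
  obtain F where F: "Y = F \<circ> (\<lambda>\<omega>. (?K \<omega>, ?L \<omega>))"
  proof (rule factors_through)
    show "Y \<omega> = Y \<omega>'" if "(?K \<omega>, ?L \<omega>) = (?K \<omega>', ?L \<omega>')" for \<omega> \<omega>'
      by (rule Y) (metis that prod.inject restrict_apply' Un_iff)
  qed
  have Yg: "(Y \<circ> g \<omega>0) \<omega> = F (?K \<omega>, ?L \<omega>0)" if "\<omega> \<in> set_pmf P" "\<omega>0 \<in> set_pmf P" for \<omega> \<omega>0
  proof -
    have "?K (g \<omega>0 \<omega>) = ?K \<omega>" "?L (g \<omega>0 \<omega>) = ?L \<omega>0"
      using that by (auto simp: g to_support_id intro!: restrict_ext)
    then show ?thesis unfolding F by (simp only: comp_apply)
  qed
  have "bind_pmf P (\<lambda>\<omega>0. map_pmf (Y \<circ> g \<omega>0) P)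
      = bind_pmf P (\<lambda>\<omega>0. map_pmf (\<lambda>\<omega>. F (?K \<omega>, ?L \<omega>0)) P)"
    by (intro bind_pmf_cong map_pmf_cong refl Yg)
  also have "\<dots> = map_pmf F (pair_pmf (map_pmf ?K P) (map_pmf ?L P))"
    unfolding pair_pmf_def map_pmf_def
    by (subst (2) bind_commute_pmf) (simp add: bind_assoc_pmf bind_return_pmf)
  also have "\<dots> = map_pmf Y P"
    unfolding joint_tuple_indep[OF indep fin disj, symmetric] F by (simp add: pmf.map_comp)
  finally show ?thesis by simp
qed

text \<open>Fixing the messages in \<open>L\<close> to suitable values does not increase the weighted sum of
  entropies, since this holds on average over the values.\<close>

lemma ent_substituted_le:
  fixes k :: "'a \<Rightarrow> real" and Y :: "'a \<Rightarrow> nat \<Rightarrow> 'b"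
  assumes indep: "prob_space.indep_vars (measure_pmf P) (\<lambda>_. count_space UNIV) M (K \<union> L)"
    and fin: "finite K" "finite L" and disj: "K \<inter> L = {}"
    and g: "\<And>\<omega>0 \<omega> h. h \<in> K \<Longrightarrow> M h (g \<omega>0 \<omega>) = M h (to_support P \<omega>)"
      "\<And>\<omega>0 \<omega> h. h \<in> L \<Longrightarrow> M h (g \<omega>0 \<omega>) = M h (to_support P \<omega>0)"
    and Y: "\<And>i \<omega> \<omega>'. (\<And>h. h \<in> K \<union> L \<Longrightarrow> M h \<omega> = M h \<omega>') \<Longrightarrow> Y i \<omega> = Y i \<omega>'"
    and finY: "\<And>i. finite (range (Y i))"
    and k: "\<And>i. i \<in> I \<Longrightarrow> 0 \<le> k i"
  obtains \<omega>0 where "(\<Sum>i\<in>I. k i * ent P (Y i \<circ> g \<omega>0)) \<le> (\<Sum>i\<in>I. k i * ent P (Y i))"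
proof -
  have mix: "map_pmf (Y i) P = bind_pmf P (\<lambda>\<omega>0. map_pmf (Y i \<circ> g \<omega>0) P)" for i
    using indep fin disj g Y by (rule mixture_of_determined)
  have int: "integrable (measure_pmf P) (\<lambda>\<omega>0. ent P (Y i \<circ> g \<omega>0))"
    and le: "measure_pmf.expectation P (\<lambda>\<omega>0. ent P (Y i \<circ> g \<omega>0)) \<le> ent P (Y i)" for i
    using expectation_ent_le[OF mix finY, of i] by auto
  let ?f = "\<lambda>\<omega>0. \<Sum>i\<in>I. k i * ent P (Y i \<circ> g \<omega>0)" and ?b = "\<Sum>i\<in>I. k i * ent P (Y i)"
  have "measure_pmf.expectation P ?f
      = (\<Sum>i\<in>I. k i * measure_pmf.expectation P (\<lambda>\<omega>0. ent P (Y i \<circ> g \<omega>0)))"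
    by (subst Bochner_Integration.integral_sum) (auto simp: int)
  also have "\<dots> \<le> ?b" by (intro sum_mono mult_left_mono le k)
  finally have "measure_pmf.expectation P (\<lambda>\<omega>0. - ?f \<omega>0) \<ge> - ?b" by simp
  moreover have "measure_pmf.expectation P (\<lambda>\<omega>0. - ?f \<omega>0) < - ?b" if "\<And>\<omega>0. ?b < ?f \<omega>0"
    using that by (intro measure_pmf.expectation_less) (auto simp: int)
  ultimately show thesis using that by (meson not_le)
qed

section \<open>Codes that carry the messages of one side only\<close>

definition arc_weight :: "('v set \<Rightarrow> real) \<Rightarrow> 'v \<times> 'v \<Rightarrow> real" where
  "arc_weight w = (\<lambda>(x, y). w {x, y})"

text \<open>The restriction concerns the content of the symbols and not their place: routes may well
  leave \<open>A\<close>.\<close>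

definition one_sided ::
  "('v \<times> 'v) set \<Rightarrow> 'v session set \<Rightarrow> ('v session \<Rightarrow> nat \<Rightarrow> nat) \<Rightarrow> 'v set
     \<Rightarrow> (('v \<times> 'v) \<times> (nat \<Rightarrow> nat)) list \<Rightarrow> bool" where
  "one_sided R H M A ts \<longleftrightarrow>
     causal R H M ts \<and>
     (\<forall>h\<in>sessions_in H A. \<forall>\<omega> \<omega>'. knows H M ts (snd h) \<omega> \<omega>' \<longrightarrow> M h \<omega> = M h \<omega>') \<and>
     (\<forall>a X \<omega> \<omega>'. (a, X) \<in> set ts \<longrightarrow> (\<forall>h\<in>sessions_in H A. M h \<omega> = M h \<omega>') \<longrightarrow> X \<omega> = X \<omega>')"

lemma (in pair_fin_digraph) one_sided_code:
  fixes H :: "'a session set" and C :: "'a block_code"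
  assumes arcs: "parcs G = arcs_of E"
    and code: "block_code E H r C" and "finite H"
    and H: "H = sessions_in H A \<union> sessions_in H B" and AB: "A \<inter> B = {}"
    and w: "\<And>a. a \<in> arcs_of E \<Longrightarrow> 0 \<le> c a"
    and \<pi>: "\<And>x. x \<in> A \<Longrightarrow> \<pi> x = x"
    and walk: "\<And>x y. (x, y) \<in> arcs_of E \<Longrightarrow> awalk (\<pi> x) (route (x, y)) (\<pi> y)"
    and cost: "\<And>a. a \<in> arcs_of E \<Longrightarrow> sum_list (map c (route a)) \<le> k a"
  defines "P \<equiv> sample C" and "M \<equiv> \<lambda>h. msg C h \<circ> to_support (sample C)"
  shows "\<exists>ts. one_sided (arcs_of E) H M A ts \<and>
    (\<Sum>a\<in>arcs_of E. c a * ent P (transmissions_on ts a))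
      \<le> (\<Sum>a\<in>arcs_of E. k a * ent P (transmissions_on (sent C) a))"
proof -
  let ?HA = "sessions_in H A" and ?HB = "sessions_in H B"
  have finE: "finite (arcs_of E)" using pair_finite_arcs arcs by simp
  have fin: "finite ?HA" "finite ?HB"
    using \<open>finite H\<close> by (auto simp: sessions_in_def)
  have disj: "?HA \<inter> ?HB = {}" using AB by (auto simp: sessions_in_def)
  note code = code[unfolded block_code_iff_causal]
  have caus: "causal (arcs_of E) H (msg C) (sent C)"
    and fmsg: "\<And>h. h \<in> H \<Longrightarrow> finite (range (msg C h))"
    and decode: "\<And>h \<omega> \<omega>'. h \<in> H \<Longrightarrow> knows H (msg C) (sent C) (snd h) \<omega> \<omega>' \<Longrightarrow>
      msg C h \<omega> = msg C h \<omega>'"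
    and indep: "prob_space.indep_vars (measure_pmf P) (\<lambda>_. count_space UNIV) (msg C) (?HA \<union> ?HB)"
    using code H by (auto simp: P_def)
  obtain g where g: "\<forall>\<omega>0 \<omega>. (\<forall>h\<in>?HA. msg C h (g \<omega>0 \<omega>) = msg C h (to_support P \<omega>)) \<and>
      (\<forall>h\<in>?HB. msg C h (g \<omega>0 \<omega>) = msg C h (to_support P \<omega>0))"
    using joint_outcome_exists[OF indep fin disj] by (rule exE)
  have gA: "msg C h (g \<omega>0 \<omega>) = msg C h (to_support P \<omega>)" if "h \<in> ?HA" for \<omega>0 \<omega> h
    using g that by blast
  have gB: "msg C h (g \<omega>0 \<omega>) = msg C h (to_support P \<omega>0)" if "h \<in> ?HB" for \<omega>0 \<omega> h
    using g that by blast
  have finT: "finite (range (transmissions_on (sent C) a))" for a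
    using caus \<open>finite H\<close> fmsg by (rule finite_range_transmissions_on)
  have route_arcs: "set (route a) \<subseteq> arcs_of E" if "a \<in> arcs_of E" for a
    using that walk arcs by (cases a) (auto simp: awalk_def)
  have c_le: "0 \<le> sum_list (map c (route a))" if "a \<in> arcs_of E" for a
    using route_arcs[OF that] by (intro sum_list_nonneg) (auto intro: w)
  have k: "0 \<le> k a" if "a \<in> arcs_of E" for a
    using c_le[OF that] cost[OF that] by linarith
  obtain \<omega>0 where \<omega>0: "(\<Sum>a\<in>arcs_of E. k a * ent P (transmissions_on (sent C) a \<circ> g \<omega>0))
      \<le> (\<Sum>a\<in>arcs_of E. k a * ent P (transmissions_on (sent C) a))"
  proof (rule ent_substituted_le[OF indep fin disj gA gB _ finT k])
    show "transmissions_on (sent C) i \<omega> = transmissions_on (sent C) i \<omega>'"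
      if "\<And>h. h \<in> ?HA \<union> ?HB \<Longrightarrow> msg C h \<omega> = msg C h \<omega>'" for i \<omega> \<omega>'
      using that unfolding H[symmetric] by (rule transmissions_on_determined[OF caus])
  qed
  define ts where "ts = relay route (g \<omega>0) (sent C)"
  \<comment> \<open>After substitution, the messages of the far side are constants and need no
    source.\<close>
  have sub: "msg C h (g \<omega>0 \<omega>) = msg C h (g \<omega>0 \<omega>')"
    if "h \<in> H" "h \<in> ?HA \<Longrightarrow> M h \<omega> = M h \<omega>'" for h \<omega> \<omega>'
  proof (cases "h \<in> ?HA")
    case True
    then show ?thesis using that(2)[OF True] gA[OF True] by (simp add: M_def P_def)
  next
    case False
    then have "h \<in> ?HB" using H that(1) by blast
    then show ?thesis by (simp add: gB)
  qed
  have gen: "msg C h (g \<omega>0 \<omega>) = msg C h (g \<omega>0 \<omega>')"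
    if "h \<in> H" "\<forall>h'\<in>H. fst h' = \<pi> (fst h) \<longrightarrow> M h' \<omega> = M h' \<omega>'" for h \<omega> \<omega>'
    by (rule sub[OF that(1)]) (use that \<pi> in \<open>auto simp: sessions_in_def\<close>)
  note sim = relay_simulates[where \<pi> = \<pi> and route = route and M' = M and g = "g \<omega>0",
      OF caus, folded ts_def, unfolded arcs]
  show ?thesis
    unfolding one_sided_def
  proof (intro exI[of _ ts] conjI ballI allI impI)
    show "causal (arcs_of E) H M ts"
      by (rule sim(1), erule walk, erule (1) gen)
    show "M h \<omega> = M h \<omega>'" if h: "h \<in> ?HA" and kn: "knows H M ts (snd h) \<omega> \<omega>'" for h \<omega> \<omega>'
    proof -
      \<comment> \<open>A sink in \<open>A\<close> is not moved by \<open>\<pi>\<close>, so the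
        simulated decoder sits at the true sink.\<close>
      have "\<pi> (snd h) = snd h" "h \<in> H" using h \<pi> by (auto simp: sessions_in_def)
      have "knows H M ts (\<pi> (snd h)) \<omega> \<omega>'"
        unfolding \<open>\<pi> (snd h) = snd h\<close> by (rule kn)
      then have "knows H (msg C) (sent C) (snd h) (g \<omega>0 \<omega>) (g \<omega>0 \<omega>')"
        by (rule sim(2)[rotated 2]) (erule walk, erule (1) gen)
      then have "msg C h (g \<omega>0 \<omega>) = msg C h (g \<omega>0 \<omega>')" by (rule decode[OF \<open>h \<in> H\<close>])
      then show ?thesis using gA[OF h] by (simp add: M_def P_def)
    qed
    show "X \<omega> = X \<omega>'"
      if mem: "(a, X) \<in> set ts" and eq: "\<forall>h\<in>?HA. M h \<omega> = M h \<omega>'" for a X \<omega> \<omega>'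
    proof -
      obtain b Y where Y: "(b, Y) \<in> set (sent C)" and X: "X = Y \<circ> g \<omega>0"
        using mem unfolding ts_def set_relay by blast
      have "Y (g \<omega>0 \<omega>) = Y (g \<omega>0 \<omega>')"
        by (rule causal_determined[OF caus Y], erule sub, rule eq[rule_format])
      then show ?thesis unfolding X comp_apply .
    qed
    have "(\<Sum>a\<in>arcs_of E. c a * ent P (transmissions_on ts a))
        \<le> (\<Sum>a\<in>arcs_of E. sum_list (map c (route a)) * ent P (transmissions_on (sent C) a \<circ> g \<omega>0))"
      unfolding ts_def
    proof (rule weighted_ent_relay_le[OF finE finE _ route_arcs w finT])
      show "fst ` set (sent C) \<subseteq> arcs_of E" using causal_arc[OF caus] by auto
    qed
    also have "\<dots> \<le> (\<Sum>a\<in>arcs_of E. k a * ent P (transmissions_on (sent C) a \<circ> g \<omega>0))"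
      using cost
      by (intro sum_mono mult_right_mono ent_nonneg finite_subset[OF _ finT]) auto
    also note \<omega>0
    finally show "(\<Sum>a\<in>arcs_of E. c a * ent P (transmissions_on ts a))
      \<le> (\<Sum>a\<in>arcs_of E. k a * ent P (transmissions_on (sent C) a))" .
  qed
qed

section \<open>Splitting a code along the cut\<close>

abbreviation digraph_of :: "'v set \<Rightarrow> 'v set set \<Rightarrow> 'v pair_pre_digraph" where
  "digraph_of V E \<equiv> \<lparr>pverts = V, parcs = arcs_of E\<rparr>"

lemma arcs_of_subset: "undirected_graph V E \<Longrightarrow> arcs_of E \<subseteq> V \<times> V"
  unfolding undirected_graph_def arcs_of_def by blast

lemma finite_arcs_of: "undirected_graph V E \<Longrightarrow> finite (arcs_of E)"
  by (rule finite_subset[OF arcs_of_subset]) (auto simp: undirected_graph_def)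

lemma pair_pseudo_graph_digraph_of:
  assumes "undirected_graph V E"
  shows "pair_pseudo_graph (digraph_of V E)"
proof -
  have "finite V" using assms by (simp add: undirected_graph_def)
  then show ?thesis
    using arcs_of_subset[OF assms] finite_arcs_of[OF assms]
    by unfold_locales (auto simp: symmetric_def sym_def arcs_of_def insert_commute)
qed

lemma arc_weight_edge: "arc_weight w (x, y) = w {x, y}"
  by (simp add: arc_weight_def)

lemma arc_weight_rev_path: "sum_list (map (arc_weight w) (rev_path p)) = sum_list (map (arc_weight w) p)"
  by (induction p) (auto simp: arc_weight_def insert_commute)

text \<open>The real bound makes the distance finite, hence \<open>y\<close> reachable; with
  nonnegative weights the infimum over walks is then attained by a path, and nothing is lost in the
  bound.\<close>

lemma walk_of_graph_dist:
  assumes graph: "undirected_graph V E" and w: "\<forall>e\<in>E. 0 \<le> w e"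
    and dist: "graph_dist V E w x y \<le> ereal b"
  obtains p where "pre_digraph.awalk (with_proj (digraph_of V E)) x p y"
    "sum_list (map (arc_weight w) p) \<le> b"
proof -
  interpret pair_pseudo_graph "digraph_of V E" using graph by (rule pair_pseudo_graph_digraph_of)
  have dist': "\<mu> (arc_weight w) x y \<le> ereal b"
    using dist by (simp add: graph_dist_def arc_weight_def)
  then have "x \<rightarrow>\<^sup>*\<^bsub>with_proj (digraph_of V E)\<^esub> y"
    unfolding \<mu>_reach_conv[of "arc_weight w", symmetric] by (rule le_less_trans) simp
  moreover have "0 \<le> arc_weight w e" if "e \<in> parcs (digraph_of V E)" for e
    using that w by (auto simp: arc_weight_def arcs_of_def)
  ultimately have "\<exists>p. apath x p y \<and> \<mu> (arc_weight w) x y = awalk_cost (arc_weight w) p"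
    by (rule min_cost_awalk)
  then obtain p where "apath x p y" "\<mu> (arc_weight w) x y = sum_list (map (arc_weight w) p)"
    unfolding awalk_cost_def by (elim exE conjE)
  with dist' show thesis by (intro that[of p]) (auto simp: apath_def)
qed

text \<open>Half of the weight of an arc is charged to each of its ends in \<open>A\<close>, so that the charges
  for the two sides of a cut add up to the weight.\<close>

definition side_cost :: "('v set \<Rightarrow> real) \<Rightarrow> 'v set \<Rightarrow> 'v \<times> 'v \<Rightarrow> real" where
  "side_cost w A a = (if fst a \<in> A then arc_weight w a / 2 else 0)
     + (if snd a \<in> A then arc_weight w a / 2 else 0)"

text \<open>An arc inside \<open>A\<close> is its own route, an arc outside \<open>A\<close>
  collapses at \<open>u\<close>, and a crossing arc becomes a path between \<open>u\<close> and its
  end in \<open>A\<close>, paid by the half charged to that end.\<close>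

lemma merge_route:
  fixes u :: 'v
  assumes graph: "undirected_graph V E" and w: "\<forall>e\<in>E. 0 \<le> w e"
    and AB: "A \<union> B = V" and u: "u \<in> A"
    and dist: "\<And>x y. x \<in> A \<Longrightarrow> y \<in> B \<Longrightarrow> {x, y} \<in> E \<Longrightarrow> graph_dist V E w u x \<le> ereal (w {x, y} / 2)"
    and arc: "(x, y) \<in> arcs_of E"
  defines "\<pi> \<equiv> \<lambda>x. if x \<in> A then x else u"
  shows "\<exists>p. pre_digraph.awalk (with_proj (digraph_of V E)) (\<pi> x) p (\<pi> y)
    \<and> sum_list (map (arc_weight w) p) \<le> side_cost w A (x, y)"
proof -
  interpret pair_pseudo_graph "digraph_of V E" using graph by (rule pair_pseudo_graph_digraph_of)
  have V: "x \<in> V" "y \<in> V" "u \<in> V" using arcs_of_subset[OF graph] arc AB u by auto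
  have E: "{x, y} \<in> E" "{y, x} \<in> E" using arc by (auto simp: arcs_of_def insert_commute)
  consider "x \<in> A" "y \<in> A" | "x \<in> A" "y \<notin> A" | "x \<notin> A" "y \<in> A" | "x \<notin> A" "y \<notin> A" by blast
  then show ?thesis
  proof cases
    case 1
    then show ?thesis
      using arc V by (intro exI[of _ "[(x, y)]"])
        (auto simp: \<pi>_def awalk_Cons_iff awalk_Nil_iff side_cost_def)
  next
    case 2
    then have "y \<in> B" using V AB by blast
    obtain p where p: "awalk u p x" "sum_list (map (arc_weight w) p) \<le> w {x, y} / 2"
      by (rule walk_of_graph_dist[OF graph w dist[OF 2(1) \<open>y \<in> B\<close> E(1)]])
    \<comment> \<open>The bound is on the distance from \<open>u\<close>, whereas an arc leaving
      \<open>A\<close> needs a path towards \<open>u\<close>. Reversal costs nothing, as both arcs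
      of an edge have its weight.\<close>
    then have "awalk x (rev_path p) u" by simp
    with p 2 show ?thesis
      by (intro exI[of _ "rev_path p"])
        (auto simp: \<pi>_def side_cost_def arc_weight_rev_path arc_weight_edge)
  next
    case 3
    then have "x \<in> B" using V AB by blast
    obtain p where "awalk u p y" "sum_list (map (arc_weight w) p) \<le> w {y, x} / 2"
      by (rule walk_of_graph_dist[OF graph w dist[OF 3(2) \<open>x \<in> B\<close> E(2)]])
    with 3 show ?thesis
      by (intro exI[of _ p]) (auto simp: \<pi>_def side_cost_def arc_weight_edge insert_commute[of x y])
  next
    case 4
    then show ?thesis
      using V by (intro exI[of _ "[]"]) (auto simp: \<pi>_def side_cost_def awalk_Nil_iff)
  qed
qed

lemma one_sided_code_of_reference_node:
  fixes u :: 'v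
  assumes graph: "undirected_graph V E" and w: "\<forall>e\<in>E. 0 \<le> w e"
    and AB: "A \<union> B = V" "A \<inter> B = {}" and u: "u \<in> A"
    and dist: "\<And>x y. x \<in> A \<Longrightarrow> y \<in> B \<Longrightarrow> {x, y} \<in> E \<Longrightarrow> graph_dist V E w u x \<le> ereal (w {x, y} / 2)"
    and code: "block_code E H r C" and "finite H"
    and H: "H = sessions_in H A \<union> sessions_in H B"
  defines "P \<equiv> sample C" and "M \<equiv> \<lambda>h. msg C h \<circ> to_support (sample C)"
  shows "\<exists>ts. one_sided (arcs_of E) H M A ts \<and>
    (\<Sum>a\<in>arcs_of E. arc_weight w a * ent P (transmissions_on ts a))
      \<le> (\<Sum>a\<in>arcs_of E. side_cost w A a * ent P (transmissions_on (sent C) a))"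
proof -
  interpret pair_pseudo_graph "digraph_of V E" using graph by (rule pair_pseudo_graph_digraph_of)
  define \<pi> where "\<pi> = (\<lambda>x. if x \<in> A then x else u)"
  have "\<exists>p. awalk (\<pi> (fst a)) p (\<pi> (snd a)) \<and> sum_list (map (arc_weight w) p) \<le> side_cost w A a"
    if "a \<in> arcs_of E" for a
    using merge_route[OF graph w AB(1) u dist, of "fst a" "snd a"] that unfolding \<pi>_def by simp
  then obtain route where route:
    "\<And>a. a \<in> arcs_of E \<Longrightarrow> awalk (\<pi> (fst a)) (route a) (\<pi> (snd a))"
    "\<And>a. a \<in> arcs_of E \<Longrightarrow> sum_list (map (arc_weight w) (route a)) \<le> side_cost w A a"
    by metis
  show ?thesis
    unfolding P_def M_def
  proof (rule one_sided_code[OF _ code \<open>finite H\<close> H AB(2), where \<pi> = \<pi> and route = route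
        and c = "arc_weight w" and k = "side_cost w A"])
    show "0 \<le> arc_weight w a" if "a \<in> arcs_of E" for a
      using that w by (auto simp: arc_weight_def arcs_of_def)
    show "awalk (\<pi> x) (route (x, y)) (\<pi> y)" if "(x, y) \<in> arcs_of E" for x y
      using route(1)[OF that] by simp
  qed (use route(2) in \<open>simp_all add: \<pi>_def\<close>)
qed

definition code_cost :: "'v set set \<Rightarrow> ('v set \<Rightarrow> real) \<Rightarrow> 'v block_code \<Rightarrow> real" where
  "code_cost E w C = (\<Sum>a\<in>arcs_of E. arc_weight w a * block_rate C a)"

definition separated :: "'v session set \<Rightarrow> 'v set \<Rightarrow> 'v set \<Rightarrow> 'v block_code \<Rightarrow> bool" where
  "separated H A B C \<longleftrightarrow> (\<forall>h1\<in>sessions_in H A. \<forall>h2\<in>sessions_in H B. \<forall>a X.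
     (a, X) \<in> set (sent C) \<longrightarrow> info_about H C X h1 * info_about H C X h2 = 0)"

text \<open>The schedules of the two sides share the sample space and the messages \<open>M\<close>,
  while their frozen outcomes are unrelated. Concatenated they serve all of \<open>H\<close>, since
  every session lies on one side.\<close>

lemma separated_code:
  fixes u v :: 'v
  assumes graph: "undirected_graph V E" and w: "\<forall>e\<in>E. 0 \<le> w e"
    and AB: "A \<union> B = V" "A \<inter> B = {}" and uv: "u \<in> A" "v \<in> B"
    and dist: "\<And>x y. x \<in> A \<Longrightarrow> y \<in> B \<Longrightarrow> {x, y} \<in> E \<Longrightarrow>
      graph_dist V E w u x \<le> ereal (w {x, y} / 2) \<and> graph_dist V E w v y \<le> ereal (w {x, y} / 2)"
    and code: "block_code E H r C" and "finite H"
    and H: "H = sessions_in H A \<union> sessions_in H B"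
  shows "\<exists>D. block_code E H r D \<and> code_cost E w D \<le> code_cost E w C \<and> separated H A B D"
proof -
  define P where "P = sample C"
  define M where "M = (\<lambda>h. msg C h \<circ> to_support (sample C))"
  have dA: "graph_dist V E w u x \<le> ereal (w {x, y} / 2)"
    if "x \<in> A" "y \<in> B" "{x, y} \<in> E" for x y using dist that by blast
  have dB: "graph_dist V E w v y \<le> ereal (w {y, x} / 2)"
    if "y \<in> B" "x \<in> A" "{y, x} \<in> E" for x y using dist[of x y] that by (simp add: insert_commute)
  have BA: "B \<union> A = V" "B \<inter> A = {}" "H = sessions_in H B \<union> sessions_in H A" using AB H by blast+
  obtain tsA where tsA: "one_sided (arcs_of E) H M A tsA"
    "(\<Sum>a\<in>arcs_of E. arc_weight w a * ent P (transmissions_on tsA a))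
      \<le> (\<Sum>a\<in>arcs_of E. side_cost w A a * ent P (transmissions_on (sent C) a))"
    using one_sided_code_of_reference_node[OF graph w AB uv(1) dA code \<open>finite H\<close> H]
    unfolding P_def M_def by blast
  note A = tsA(1)[unfolded one_sided_def, THEN conjunct1]
    tsA(1)[unfolded one_sided_def, THEN conjunct2, THEN conjunct1, rule_format]
    tsA(1)[unfolded one_sided_def, THEN conjunct2, THEN conjunct2, rule_format] tsA(2)
  obtain tsB where tsB: "one_sided (arcs_of E) H M B tsB"
    "(\<Sum>a\<in>arcs_of E. arc_weight w a * ent P (transmissions_on tsB a))
      \<le> (\<Sum>a\<in>arcs_of E. side_cost w B a * ent P (transmissions_on (sent C) a))"
    using one_sided_code_of_reference_node[OF graph w BA(1,2) uv(2) dB code \<open>finite H\<close> BA(3)]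
    unfolding P_def M_def by blast
  note B = tsB(1)[unfolded one_sided_def, THEN conjunct1]
    tsB(1)[unfolded one_sided_def, THEN conjunct2, THEN conjunct1, rule_format]
    tsB(1)[unfolded one_sided_def, THEN conjunct2, THEN conjunct2, rule_format] tsB(2)
  define D where
    "D = \<lparr>block_length = block_length C, sample = P, msg = M, sent = tsA @ tsB\<rparr>"
  have D: "block_length D = block_length C" "sample D = P" "msg D = M" "sent D = tsA @ tsB"
    by (simp_all add: D_def)
  note code = code[unfolded block_code_iff_causal]
  have fM: "finite (range (M h))" if "h \<in> H" for h
    by (rule finite_subset[of _ "range (msg C h)"]) (use code that in \<open>auto simp: M_def\<close>)
  have caus: "causal (arcs_of E) H M (tsA @ tsB)" using A(1) B(1) by (rule causal_append)
  have "block_code E H r D"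
    unfolding block_code_iff_causal D
  proof (intro conjI ballI allI impI caus fM)
    \<comment> \<open>\<open>to_support\<close> changes null outcomes only, so it preserves
      \<open>P\<close> and the messages stay independent.\<close>
    have "map_pmf (to_support P) P = P"
      using map_pmf_to_support[of id P] by (simp add: pmf.map_id comp_def)
    then show "prob_space.indep_vars (measure_pmf P) (\<lambda>_. count_space UNIV) M H"
      unfolding M_def P_def[symmetric] using code
      by (intro indep_vars_map_pmf) (simp add: P_def)
    show "ent P (M h) = real (block_length C) * r h" if "h \<in> H" for h
    proof -
      have "ent P (M h) = ent P (msg C h)"
        by (rule ent_cong_distribution[OF _ fM[OF that]])
          (use code that in \<open>auto simp: M_def P_def map_pmf_to_support\<close>)
      then show ?thesis using code that by (simp add: P_def)
    qed
    show "M h \<omega> = M h \<omega>'" if "h \<in> H" "knows H M (tsA @ tsB) (snd h) \<omega> \<omega>'" for h \<omega> \<omega>'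
    proof (cases "h \<in> sessions_in H A")
      case True
      then show ?thesis by (rule A(2)) (rule knows_mono[OF that(2)], simp)
    next
      case False
      then have "h \<in> sessions_in H B" using H that(1) by blast
      then show ?thesis by (rule B(2)) (rule knows_mono[OF that(2)], simp)
    qed
  qed (use code in auto)
  moreover have "code_cost E w D \<le> code_cost E w C"
  proof -
    have fin: "finite (range (transmissions_on tsA a))" "finite (range (transmissions_on tsB a))" for a
      using A(1) B(1) \<open>finite H\<close> fM by (auto intro: finite_range_transmissions_on)
    have on_arc: "ent P (transmissions_on (tsA @ tsB) a)
        \<le> ent P (transmissions_on tsA a) + ent P (transmissions_on tsB a)" for a
    proof -
      have "ent P (transmissions_on (tsA @ tsB) a)
          \<le> ent P (\<lambda>\<omega>. (transmissions_on tsA a \<omega>, transmissions_on tsB a \<omega>))"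
      proof (rule ent_le_of_determined)
        show "finite (range (\<lambda>\<omega>. (transmissions_on tsA a \<omega>, transmissions_on tsB a \<omega>)))"
          by (rule finite_subset[OF _ finite_cartesian_product[OF fin[of a]]]) auto
      qed (simp add: transmissions_on_append)
      also have "\<dots> \<le> ent P (transmissions_on tsA a) + ent P (transmissions_on tsB a)"
        using fin by (rule ent_pair_le)
      finally show ?thesis .
    qed
    have w0: "0 \<le> arc_weight w a" if "a \<in> arcs_of E" for a
      using that w by (auto simp: arc_weight_def arcs_of_def)
    have sides: "side_cost w A a + side_cost w B a = arc_weight w a" if "a \<in> arcs_of E" for a
      using that arcs_of_subset[OF graph] AB by (auto simp: side_cost_def)
    have "(\<Sum>a\<in>arcs_of E. arc_weight w a * ent P (transmissions_on (tsA @ tsB) a))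
        \<le> (\<Sum>a\<in>arcs_of E. arc_weight w a * ent P (transmissions_on tsA a))
          + (\<Sum>a\<in>arcs_of E. arc_weight w a * ent P (transmissions_on tsB a))"
      unfolding sum.distrib[symmetric] distrib_left[symmetric]
      by (intro sum_mono mult_left_mono on_arc w0)
    also have "\<dots> \<le> (\<Sum>a\<in>arcs_of E. side_cost w A a * ent P (transmissions_on (sent C) a))
          + (\<Sum>a\<in>arcs_of E. side_cost w B a * ent P (transmissions_on (sent C) a))"
      using A(4) B(4) by (rule add_mono)
    also have "\<dots> = (\<Sum>a\<in>arcs_of E. arc_weight w a * ent P (transmissions_on (sent C) a))"
      unfolding sum.distrib[symmetric] distrib_right[symmetric]
      by (intro sum.cong refl) (simp add: sides)
    finally show ?thesis
      unfolding code_cost_def block_rate_def on_arc_eq D P_def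
      by (simp add: divide_right_mono flip: sum_divide_distrib)
  qed
  moreover have "info_about H D X h1 * info_about H D X h2 = 0"
    if X: "(a, X) \<in> set (sent D)" and h: "h1 \<in> sessions_in H A" "h2 \<in> sessions_in H B" for a X h1 h2
  proof -
    have fX: "finite (range X)"
      using caus \<open>finite H\<close> fM X unfolding D by (rule finite_range_symbol)
    \<comment> \<open>Conditioning on all messages but that of \<open>h\<close> already fixes
      \<open>X\<close> when \<open>h\<close> lies on the side that \<open>X\<close> ignores;
      \<open>K\<close> is the set of sessions on the other side.\<close>
    have zero: "info_about H D X h = 0"
      if "h \<in> H" "K \<subseteq> H - {h}" and det: "\<And>\<omega> \<omega>'. \<forall>h\<in>K. M h \<omega> = M h \<omega>' \<Longrightarrow> X \<omega> = X \<omega>'"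
      for h K
      unfolding info_about_def D
    proof (rule cond_mut_info_eq_0)
      show "finite (range (\<lambda>\<omega>. \<lambda>h'\<in>H - {h}. M h' \<omega>))"
        using \<open>finite H\<close> fM by (intro finite_range_restrict) auto
      show "X \<omega> = X \<omega>'" if eq: "(\<lambda>h'\<in>H - {h}. M h' \<omega>) = (\<lambda>h'\<in>H - {h}. M h' \<omega>')" for \<omega> \<omega>'
        using fun_cong[OF eq] \<open>K \<subseteq> H - {h}\<close> by (intro det) (metis restrict_apply' subsetD)
    qed (use fX fM \<open>h \<in> H\<close> in auto)
    have sub: "sessions_in H A \<subseteq> H - {h2}" "sessions_in H B \<subseteq> H - {h1}" "h1 \<in> H" "h2 \<in> H"
      using h AB(2) by (auto simp: sessions_in_def)
    consider "(a, X) \<in> set tsA" | "(a, X) \<in> set tsB" using X unfolding D by auto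
    then show ?thesis
    proof cases
      case 1
      have "info_about H D X h2 = 0"
        by (rule zero[OF sub(4,1)], rule A(3)[OF 1], erule (1) bspec)
      then show ?thesis by simp
    next
      case 2
      have "info_about H D X h1 = 0"
        by (rule zero[OF sub(3,2)], rule B(3)[OF 2], erule (1) bspec)
      then show ?thesis by simp
    qed
  qed
  ultimately show ?thesis unfolding separated_def by blast
qed

section \<open>Minimum-cost solutions\<close>

text \<open>All transmissions on an arc are a function of the messages, whose total entropy is
  prescribed. The bound is uniform over all codes, which provides the compactness for the
  limit.\<close>

lemma block_rate_bounds:
  assumes "block_code E H r C" "finite H"
  shows "0 \<le> block_rate C a" "block_rate C a \<le> (\<Sum>h\<in>H. r h)"
proof -
  note code = assms(1)[unfolded block_code_iff_causal]
  have caus: "causal (arcs_of E) H (msg C) (sent C)" and f: "\<And>h. h \<in> H \<Longrightarrow> finite (range (msg C h))"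
    and n: "0 < real (block_length C)"
    using code by auto
  have "0 \<le> ent (sample C) (on_arc C a)"
    unfolding on_arc_eq by (intro ent_nonneg finite_range_transmissions_on[OF caus \<open>finite H\<close> f])
  then show "0 \<le> block_rate C a" by (simp add: block_rate_def)
  have "ent (sample C) (on_arc C a) \<le> (\<Sum>h\<in>H. ent (sample C) (msg C h))"
    unfolding on_arc_eq using \<open>finite H\<close> f transmissions_on_determined[OF caus]
    by (rule ent_le_sum_of_determined)
  also have "\<dots> = real (block_length C) * (\<Sum>h\<in>H. r h)"
    using code by (simp add: sum_distrib_left)
  finally show "block_rate C a \<le> (\<Sum>h\<in>H. r h)"
    using n by (simp add: block_rate_def divide_le_eq mult.commute)
qed

text \<open>Bolzano-Weierstrass for one index after another; passing to a further subsequence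
  preserves the limits already obtained.\<close>

lemma simultaneously_convergent_subsequence:
  fixes f :: "'a \<Rightarrow> nat \<Rightarrow> real"
  assumes "finite A" "\<And>a. a \<in> A \<Longrightarrow> bounded (range (f a))"
  shows "\<exists>s. strict_mono s \<and> (\<forall>a\<in>A. convergent (f a \<circ> s))"
  using assms
proof (induction A)
  case empty
  show ?case by (auto intro: strict_mono_id)
next
  case (insert a A)
  then obtain s where s: "strict_mono s" "\<forall>b\<in>A. convergent (f b \<circ> s)" by blast
  have "bounded (range (f a \<circ> s))"
    by (rule bounded_subset[of "range (f a)"]) (use insert in auto)
  then obtain l t where t: "strict_mono t" "((f a \<circ> s) \<circ> t) \<longlonglongrightarrow> l"
    using bounded_imp_convergent_subsequence by blast
  show ?case
  proof (intro exI[of _ "s \<circ> t"] conjI ballI)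
    show "strict_mono (s \<circ> t)" using s t by (intro strict_mono_o)
    fix b assume "b \<in> insert a A"
    then show "convergent (f b \<circ> (s \<circ> t))"
    proof
      assume "b = a"
      then show ?thesis using t(2) by (auto simp: convergent_def o_assoc)
    next
      assume "b \<in> A"
      then have "convergent ((f b \<circ> s) \<circ> t)" using s(2) t(1) by (blast intro: convergent_subseq_convergent)
      then show ?thesis by (simp only: o_assoc)
    qed
  qed
qed

lemma total_cost_eq:
  assumes "undirected_graph V E"
  shows "total_cost E w S = (\<Sum>a\<in>arcs_of E. arc_weight w a * flow S a)"
proof -
  have finE: "finite E"
    using assms by (auto simp: undirected_graph_def intro: finite_subset[of _ "Pow V"])
  have "(\<Sum>a\<in>arcs_of E. arc_weight w a * flow S a)
      = (\<Sum>e\<in>E. \<Sum>a\<in>{a\<in>arcs_of E. (\<lambda>(x, y). {x, y}) a = e}. arc_weight w a * flow S a)"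
    by (rule sum.group[symmetric]) (use finite_arcs_of[OF assms] finE in \<open>auto simp: arcs_of_def\<close>)
  also have "\<dots> = total_cost E w S"
    unfolding total_cost_def edge_flow_def sum_distrib_left
    by (intro sum.cong) (auto simp: arcs_of_def arc_weight_def)
  finally show ?thesis by simp
qed

lemma total_cost_lim:
  assumes "undirected_graph V E" "coding_solution E H r S"
  shows "(\<lambda>n. code_cost E w (S n)) \<longlonglongrightarrow> total_cost E w S"
  unfolding total_cost_eq[OF assms(1)] code_cost_def flow_def
  using assms(2) by (intro tendsto_sum tendsto_mult tendsto_const)
    (auto simp: coding_solution_def convergent_LIMSEQ_iff)

text \<open>Since the rates on all arcs are bounded by the total demand, the infimum of the costs is
  attained in the limit, and it can be approached by codes of any class that contains a code at
  least as cheap as any given one.\<close>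

lemma min_cost_solution_exists:
  assumes graph: "undirected_graph V E" and w: "\<forall>e\<in>E. 0 \<le> w e" and "finite H"
    and feasible: "\<exists>S. coding_solution E H r S"
    and improve: "\<And>C. block_code E H r C \<Longrightarrow>
      \<exists>D. block_code E H r D \<and> code_cost E w D \<le> code_cost E w C \<and> Q D"
  shows "\<exists>S. min_cost_coding_solution E w H r S \<and> (\<forall>n. Q (S n))"
proof -
  let ?costs = "code_cost E w ` {C. block_code E H r C}"
  \<comment> \<open>The infimum is over single block codes. Costs of solutions are limits of such
    costs, so \<open>m\<close> is a lower bound for them too.\<close>
  define m where "m = Inf ?costs"
  have "0 \<le> code_cost E w C" if "block_code E H r C" for C
    unfolding code_cost_def
    using w block_rate_bounds(1)[OF that \<open>finite H\<close>]
    by (intro sum_nonneg mult_nonneg_nonneg) (auto simp: arc_weight_def arcs_of_def)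
  then have bdd: "bdd_below ?costs" by (intro bdd_belowI[of _ 0]) auto
  have m_le: "m \<le> code_cost E w C" if "block_code E H r C" for C
    unfolding m_def using that bdd by (intro cInf_lower) auto
  have ne: "?costs \<noteq> {}" using feasible by (auto simp: coding_solution_def)
  have "\<exists>D. block_code E H r D \<and> code_cost E w D \<le> m + 1 / real (Suc n) \<and> Q D" for n
  proof -
    have "Inf ?costs < m + 1 / real (Suc n)" by (simp add: m_def)
    then have "\<exists>x\<in>?costs. x < m + 1 / real (Suc n)"
      unfolding cInf_less_iff[OF ne bdd] .
    then obtain C where C: "block_code E H r C" "code_cost E w C < m + 1 / real (Suc n)" by auto
    with improve[OF C(1)] show ?thesis by fastforce
  qed
  then obtain D where D: "\<And>n. block_code E H r (D n)"
    "\<And>n. code_cost E w (D n) \<le> m + 1 / real (Suc n)" "\<And>n. Q (D n)" by metis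
  have "bounded (range (\<lambda>n. block_rate (D n) a))" for a
  proof (rule boundedI)
    fix x assume "x \<in> range (\<lambda>n. block_rate (D n) a)"
    then obtain n where "x = block_rate (D n) a" by blast
    then show "norm x \<le> (\<Sum>h\<in>H. r h)"
      using block_rate_bounds[OF D(1)[of n] \<open>finite H\<close>, of a] by simp
  qed
  then obtain s where s: "strict_mono s"
    "\<And>a. a \<in> arcs_of E \<Longrightarrow> convergent ((\<lambda>n. block_rate (D n) a) \<circ> s)"
    using simultaneously_convergent_subsequence[OF finite_arcs_of[OF graph], of "\<lambda>a n. block_rate (D n) a"]
    by blast
  let ?S = "D \<circ> s"
  have sol: "coding_solution E H r ?S"
    using D(1) s(2) by (simp add: coding_solution_def comp_def)
  have "total_cost E w ?S \<le> m"
  proof (rule LIMSEQ_le)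
    show "(\<lambda>n. code_cost E w (?S n)) \<longlonglongrightarrow> total_cost E w ?S"
      using graph sol by (rule total_cost_lim)
    have "((\<lambda>n. m + 1 / real (Suc n)) \<circ> s) \<longlonglongrightarrow> m + 0"
      by (intro LIMSEQ_subseq_LIMSEQ[OF _ s(1)] tendsto_add tendsto_const lim_1_over_n[THEN LIMSEQ_Suc])
    then show "((\<lambda>n. m + 1 / real (Suc n)) \<circ> s) \<longlonglongrightarrow> m" by simp
    show "\<exists>N. \<forall>n\<ge>N. code_cost E w (?S n) \<le> ((\<lambda>n. m + 1 / real (Suc n)) \<circ> s) n"
      using D(2) by auto
  qed
  moreover have "m \<le> total_cost E w S'" if "coding_solution E H r S'" for S'
    by (rule LIMSEQ_le_const[OF total_cost_lim[OF graph that]])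
      (use that m_le in \<open>auto simp: coding_solution_def\<close>)
  ultimately have "min_cost_coding_solution E w H r ?S"
    unfolding min_cost_coding_solution_def using sol by (meson order_trans)
  then show ?thesis using D(3) by auto
qed

theorem mainTheorem6:
  fixes V :: "'v set" and E :: "'v set set" and w :: "'v set \<Rightarrow> real"
    and H :: "'v session set" and r :: "'v session \<Rightarrow> real"
    and V\<^sub>U V\<^sub>V :: "'v set" and u v :: 'v
  assumes "undirected_graph V E"
    and "\<forall>e\<in>E. 0 \<le> w e"
    and "H \<subseteq> V \<times> V"
    and "\<forall>h\<in>H. 0 \<le> r h"
    and feasible: "\<exists>S. coding_solution E H r S"
    and "is_cut V V\<^sub>U V\<^sub>V"
    and "H = sessions_in H V\<^sub>U \<union> sessions_in H V\<^sub>V"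
    and "u \<in> V\<^sub>U" and "v \<in> V\<^sub>V" and "{u, v} \<notin> E"
    and "\<forall>x\<in>V\<^sub>U. \<forall>y\<in>V\<^sub>V. {x, y} \<in> cut_edges E V\<^sub>U V\<^sub>V \<longrightarrow>
           ereal (1/2 * w {x, y}) \<ge> max (graph_dist V E w u x) (graph_dist V E w v y)"
  shows "independent_sessions E w H r (sessions_in H V\<^sub>U) (sessions_in H V\<^sub>V)"
proof -
  have "finite V" using assms(1) by (simp add: undirected_graph_def)
  then have finH: "finite H" using assms(3) by (auto intro: finite_subset)
  have cut: "V\<^sub>U \<union> V\<^sub>V = V" "V\<^sub>U \<inter> V\<^sub>V = {}" using assms(6) by (auto simp: is_cut_def)
  have dist: "graph_dist V E w u x \<le> ereal (w {x, y} / 2) \<and> graph_dist V E w v y \<le> ereal (w {x, y} / 2)"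
    if "x \<in> V\<^sub>U" "y \<in> V\<^sub>V" "{x, y} \<in> E" for x y
  proof -
    have "{x, y} \<in> cut_edges E V\<^sub>U V\<^sub>V" using that by (auto simp: cut_edges_def)
    with assms(11) that show ?thesis by (simp add: mult.commute)
  qed
  \<comment> \<open>Here the class of codes \<open>Q\<close> is
    \<open>separated H V\<^sub>U V\<^sub>V\<close>.\<close>
  have "\<exists>S. min_cost_coding_solution E w H r S \<and> (\<forall>n. separated H V\<^sub>U V\<^sub>V (S n))"
    by (rule min_cost_solution_exists[OF assms(1,2) finH feasible],
        rule separated_code[OF assms(1,2) cut assms(8,9) dist _ finH assms(7)])
  then obtain S where S: "min_cost_coding_solution E w H r S" "\<And>n. separated H V\<^sub>U V\<^sub>V (S n)"
    by blast
  show ?thesis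
    unfolding independent_sessions_def
  proof (intro conjI exI[of _ S] ballI allI S(1))
    show "sessions_in H V\<^sub>U \<inter> sessions_in H V\<^sub>V = {}"
      using cut(2) by (auto simp: sessions_in_def)
    show "info_about H (S n) X h1 * info_about H (S n) X h2 = 0"
      if "h1 \<in> sessions_in H V\<^sub>U" "h2 \<in> sessions_in H V\<^sub>V" "X \<in> symbols_on (S n) e" for h1 h2 e n X
      using S(2)[of n] that unfolding separated_def symbols_on_def by blast
  qed (auto simp: sessions_in_def)
qed

end
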